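(* Let $\alpha\in(0,1)$, let $N,M$ be integers with $N\ge 1$ and $M\ge 1$, and let $f:(0,+\infty)\to\mathbb{R}$ be continuous and satisfy $$-\infty<B:=\liminf_{v\to 0^+}\frac{f(v)}{v}\le A:=\limsup_{v\to 0^+}\frac{f(v)}{v}<1.$$ Let $u$ be a positive classical solution of $$(-\Delta)_x^{\alpha}u+(-\Delta)_y u+u=f(u)\ \text{ in }\mathbb{R}^N\times\mathbb{R}^M,\qquad u>0\ \text{ in }\mathbb{R}^N\times\mathbb{R}^M,\qquad \lim_{|(x,y)|\to+\infty}u(x,y)=0.$$ Then for every sufficiently small $\epsilon>0$ there exists $C_\epsilon>1$ such that for all $(x,y)\in\mathbb{R}^N\times\mathbb{R}^M$, $$C_\epsilon^{-1}(1+|x|)^{-N-2\alpha}e^{-\theta_2|y|}\le u(x,y)\le C_\epsilon(1+|x|)^{-N-2\alpha}e^{-\theta_1|y|},$$ where $\theta_1=\sqrt{1-A}-\epsilon$ and $\theta_2=\sqrt{1-B}+\epsilon$.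
   Context: Points of $\mathbb{R}^N\times\mathbb{R}^M$ are written $(x,y)$. $(-\Delta)_y$ denotes the usual (minus) Laplacian in the variable $y\in\mathbb{R}^M$, i.e. $(-\Delta)_y u=-\sum_{i=1}^M\partial_{y_i}^2u$. $(-\Delta)_x^\alpha$ denotes the fractional Laplacian in the variable $x$, normalized as $$(-\Delta)_x^\alpha u(x,y)=\int_{\mathbb{R}^N}\frac{u(x,y)-u(z,y)}{|x-z|^{N+2\alpha}}\,dz,$$ the integral being understood in the principal value sense. *)

theory Defs
  imports "HOL-Analysis.Analysis"
begin

definition frac_trunc_x ::
  "real \<Rightarrow> ((real^'n) \<times> (real^'m) \<Rightarrow> real) \<Rightarrow> (real^'n) \<Rightarrow> (real^'m) \<Rightarrow> real \<Rightarrow> real" where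
  "frac_trunc_x \<alpha> u x y r =
     (LINT z:{z. r < norm (x - z)}|lborel.
        (u (x, y) - u (z, y)) / norm (x - z) powr (real CARD('n) + 2 * \<alpha>))"

text \<open>The principal value is the limit, as \<open>r\<close> decreases to 0, of absolutely convergent integrals
  over the complements of the balls of radius \<open>r\<close> centred at \<open>x\<close>.\<close>

definition frac_laplacian_x_exists ::
  "real \<Rightarrow> ((real^'n) \<times> (real^'m) \<Rightarrow> real) \<Rightarrow> (real^'n) \<Rightarrow> (real^'m) \<Rightarrow> bool" where
  "frac_laplacian_x_exists \<alpha> u x y \<longleftrightarrow>
     (\<forall>r>0. set_integrable lborel {z. r < norm (x - z)}
        (\<lambda>z. (u (x, y) - u (z, y)) / norm (x - z) powr (real CARD('n) + 2 * \<alpha>))) \<and>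
     (\<exists>L. (frac_trunc_x \<alpha> u x y \<longlongrightarrow> L) (at_right 0))"

definition frac_laplacian_x ::
  "real \<Rightarrow> ((real^'n) \<times> (real^'m) \<Rightarrow> real) \<Rightarrow> (real^'n) \<Rightarrow> (real^'m) \<Rightarrow> real" where
  "frac_laplacian_x \<alpha> u x y = Lim (at_right 0) (frac_trunc_x \<alpha> u x y)"

definition partial_y ::
  "'m \<Rightarrow> ((real^'n) \<times> (real^'m) \<Rightarrow> real) \<Rightarrow> (real^'n) \<times> (real^'m) \<Rightarrow> real" where
  "partial_y i u = (\<lambda>(x, y). deriv (\<lambda>t. u (x, y + t *\<^sub>R axis i 1)) 0)"

definition has_partial_y ::
  "'m \<Rightarrow> ((real^'n) \<times> (real^'m) \<Rightarrow> real) \<Rightarrow> bool" where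
  "has_partial_y i u \<longleftrightarrow>
     (\<forall>x y. (\<lambda>t. u (x, y + t *\<^sub>R axis i 1)) field_differentiable (at 0))"

definition minus_laplacian_y ::
  "((real^'n) \<times> (real^'m) \<Rightarrow> real) \<Rightarrow> (real^'n) \<Rightarrow> (real^'m) \<Rightarrow> real" where
  "minus_laplacian_y u x y = - (\<Sum>i\<in>UNIV. partial_y i (partial_y i u) (x, y))"

text \<open>A classical solution is a continuous function for which both operators are defined at every
  point and the equation holds pointwise; no continuity of the second derivatives in \<open>y\<close> is
  required. Only the values of \<open>f\<close> on the range of \<open>u\<close> matter, hence, for positive \<open>u\<close>, only those
  on the positive half-line.\<close>

definition classical_solution ::
  "real \<Rightarrow> (real \<Rightarrow> real) \<Rightarrow> ((real^'n) \<times> (real^'m) \<Rightarrow> real) \<Rightarrow> bool" where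
  "classical_solution \<alpha> f u \<longleftrightarrow>
     continuous_on UNIV u \<and>
     (\<forall>x y. frac_laplacian_x_exists \<alpha> u x y) \<and>
     (\<forall>i. has_partial_y i u \<and> has_partial_y i (partial_y i u)) \<and>
     (\<forall>x y. frac_laplacian_x \<alpha> u x y + minus_laplacian_y u x y + u (x, y) = f (u (x, y)))"

end

theory Submission imports Defs begin

text \<open>
  Write \<open>N\<close> and \<open>M\<close> for the dimensions of the two factors and \<open>p = (N + 2 \<alpha>) / 2\<close>. Both inequalities come
  from comparing \<open>u\<close> with multiples of one explicit product
    \<open>W (x, y) = (R\<^sup>2 + |x|\<^sup>2) powr (-p) * exp (- \<theta> * sqrt (1 + |y|\<^sup>2))\<close>,
  whose size is \<open>(1 + |x|) powr (- N - 2 \<alpha>) * exp (- \<theta> * |y|)\<close> up to constants.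

  The point is that the nonlocal operator is small on the first factor when \<open>R\<close> is large: up to a
  constant that does not depend on \<open>R\<close>, the fractional Laplacian of that factor is bounded in absolute
  value by \<open>R powr (- 2 \<alpha>)\<close> times the factor itself, at every point (\<open>profile_nonlocal_bound\<close>). The
  exponent \<open>N + 2 \<alpha>\<close> is exactly the decay of the kernel, and this is why the contribution of
  far away mass does not exceed the value of the factor. So for large \<open>R\<close> the whole operator acts on \<open>W\<close>
  almost like the operator in \<open>y\<close>, where \<open>-\<Delta>\<close> of the exponential is at least \<open>- \<theta>\<^sup>2\<close> times the
  exponential everywhere, and at most \<open>- \<theta>\<^sup>2 + o(1)\<close> times it as \<open>|y|\<close> grows.

  For the upper bound (\<open>decay_upper_bound\<close>) choose \<open>\<theta>\<^sup>2 < \<kappa> < 1 - A\<close>. Outside a large ball \<open>u\<close> is small,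
  so \<open>u\<close> satisfies \<open>L u + \<kappa> u \<le> 0\<close> there, \<open>L\<close> being the sum of the two operators, while
  \<open>L W + \<kappa> W \<ge> 0\<close> everywhere. A multiple \<open>k W\<close> lies above \<open>u\<close> on the ball, and a positive maximum of
  \<open>u - k W\<close> outside the ball is impossible.

  For the lower bound (\<open>decay_lower_bound\<close>) choose \<open>1 - B < \<kappa> < \<theta>\<^sup>2\<close>. The same argument excludes a
  positive maximum of \<open>\<delta> W - u\<close> at points with \<open>|y| \<ge> L\<close>, but for bounded \<open>y\<close> the exponential is no
  longer a subsolution. There the nonlocality helps: since \<open>u\<close> is bounded below by a positive constant \<open>c\<close>
  when \<open>|x| \<le> 2\<close> and \<open>|y| \<le> L\<close>, the mass of \<open>u - \<delta> W\<close> over the unit ball pushes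
  \<open>(-\<Delta>)\<^sup>\<alpha>\<close> of \<open>u - \<delta> W\<close> down by a multiple of \<open>c * (1 + |x|) powr (- N - 2 \<alpha>)\<close> at a point \<open>(x, y)\<close> with
  \<open>|x| > 2\<close> and \<open>|y| < L\<close>. All other terms are of order \<open>\<delta> * (1 + |x|) powr (- N - 2 \<alpha>)\<close>, so a
  small \<open>\<delta>\<close> gives a contradiction.

  At the extremal point, only the differences of \<open>u\<close> and \<open>W\<close> are compared, inside the truncated
  integrals and along coordinate lines (\<open>frac_laplacian_x_at_max\<close>, \<open>laplacian_y_at_max\<close>). Hence
  no principal value of \<open>W\<close> is ever formed, and twice differentiability of \<open>u\<close> along the coordinate lines
  suffices.
\<close>

section \<open>Second differences of the algebraic profile\<close>

lemma powr_neg_quotient: "(y / c) powr (-p) = c powr p * y powr (-p)" for y c p :: real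
proof -
  have "(y / c) powr (-p) = y powr (-p) / inverse (c powr p)"
    by (simp add: powr_divide powr_minus[of c])
  then show ?thesis by (simp only: divide_inverse inverse_inverse_eq mult.commute)
qed

lemma powr_second_difference:
  fixes p :: real
  assumes "p > 0"
  obtains C where "C > 0"
    "\<And>d. \<bar>d\<bar> \<le> 1/2 \<Longrightarrow> \<bar>(1 + d) powr (-p) + (1 - d) powr (-p) - 2\<bar> \<le> C * d\<^sup>2"
proof
  define C where "C = p * (p + 1) * 2 powr (p + 2)"
  show "C > 0" using assms by (simp add: C_def)
  define F where "F = (\<lambda>d::real. (1 + d) powr (-p) + (1 - d) powr (-p))"
  have d1: "((\<lambda>t. (1 + t) powr q) has_real_derivative q * (1 + t) powr (q - 1)) (at t)"
    if "1 + t > 0" for q t :: real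
    by (rule DERIV_cong[OF DERIV_chain2[where f = "\<lambda>z. z powr q" and g = "\<lambda>t. 1 + t" and Db = "1"]],
        rule has_real_derivative_powr[OF that]) (auto intro!: derivative_eq_intros)
  have d2: "((\<lambda>t. (1 - t) powr q) has_real_derivative - q * (1 - t) powr (q - 1)) (at t)"
    if "1 - t > 0" for q t :: real
    by (rule DERIV_cong[OF DERIV_chain2[where f = "\<lambda>z. z powr q" and g = "\<lambda>t. 1 - t" and Db = "-1"]],
        rule has_real_derivative_powr[OF that]) (auto intro!: derivative_eq_intros)
  have pos: "\<bar>F d - 2\<bar> \<le> C * d\<^sup>2" if d: "0 < d" "d \<le> 1/2" for d
  proof -
    define D where "D = (\<lambda>m::nat. if m = 0 then F
      else if m = 1 then (\<lambda>t. -p * (1 + t) powr (-p-1) + p * (1 - t) powr (-p-1))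
      else (\<lambda>t. p * (p+1) * (1 + t) powr (-p-2) + p * (p+1) * (1 - t) powr (-p-2)))"
    have "\<exists>t>0. t < d \<and> F d = (\<Sum>m<2. D m 0 / fact m * d ^ m) + D 2 t / fact 2 * d ^ 2"
    proof (rule Maclaurin)
      show "\<forall>m t. m < 2 \<and> 0 \<le> t \<and> t \<le> d \<longrightarrow> (D m has_real_derivative D (Suc m) t) (at t)"
      proof (intro allI impI)
        fix m :: nat and t :: real assume a: "m < 2 \<and> 0 \<le> t \<and> t \<le> d"
        then have t: "1 + t > 0" "1 - t > 0" using d by auto
        consider "m = 0" | "m = 1" using a by linarith
        then show "(D m has_real_derivative D (Suc m) t) (at t)"
        proof cases
          case 1
          show ?thesis unfolding 1 D_def F_def
            using DERIV_add[OF d1[OF t(1), of "-p"] d2[OF t(2), of "-p"]] by simp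
        next
          case 2
          have e: "-p-2 = -p-1-1" by simp
          show ?thesis unfolding 2 D_def e
            using DERIV_add[OF DERIV_cmult[OF d1[OF t(1), of "-p-1"], of "-p"]
                DERIV_cmult[OF d2[OF t(2), of "-p-1"], of p]]
            by (simp add: algebra_simps)
        qed
      qed
    qed (use d in \<open>auto simp: D_def\<close>)
    then obtain t where t: "0 < t" "t < d"
      and e: "F d = (\<Sum>m<2. D m 0 / fact m * d ^ m) + D 2 t / fact 2 * d ^ 2" by blast
    have "{..<2::nat} = {0, 1}" by auto
    then have e2: "F d - 2 = D 2 t / 2 * d\<^sup>2" using e by (simp add: D_def F_def)
    have b: "w powr (-p-2) \<le> 2 powr (p + 2)" if "1/2 \<le> w" for w :: real
    proof -
      have "w powr (-p-2) \<le> (1/2) powr (-p-2)"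
        by (rule powr_mono2') (use that assms in auto)
      also have "\<dots> = 2 powr (p + 2)"
        by (simp add: powr_divide powr_minus_divide[symmetric] add.commute)
      finally show ?thesis .
    qed
    have "D 2 t = p * (p+1) * ((1 + t) powr (-p-2) + (1 - t) powr (-p-2))"
      by (simp add: D_def algebra_simps)
    also have "\<dots> \<le> p * (p+1) * (2 powr (p + 2) + 2 powr (p + 2))"
      by (intro mult_left_mono add_mono b) (use t d assms in auto)
    finally have 1: "D 2 t / 2 \<le> C" by (simp add: C_def)
    have 2: "D 2 t / 2 \<ge> 0" using assms by (simp add: D_def)
    show ?thesis unfolding e2 using mult_right_mono[OF 1, of "d\<^sup>2"] 2 by (simp add: abs_mult)
  qed
  show "\<bar>(1 + d) powr (-p) + (1 - d) powr (-p) - 2\<bar> \<le> C * d\<^sup>2" if "\<bar>d\<bar> \<le> 1/2" for d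
    using pos[of "\<bar>d\<bar>"] that by (cases "d > 0"; cases "d = 0") (auto simp: F_def add.commute)
qed

definition profile :: "real \<Rightarrow> real \<Rightarrow> 'a::real_normed_vector \<Rightarrow> real" where
  "profile p R x = (R\<^sup>2 + (norm x)\<^sup>2) powr (-p)"

text \<open>With \<open>a = R\<^sup>2 + |x|\<^sup>2\<close>, \<open>c = |h|\<^sup>2\<close> and \<open>d = 2 (x \<bullet> h) / (a + c)\<close>, the bases of the two shifted powers are
  \<open>(a + c) (1 + d)\<close> and \<open>(a + c) (1 - d)\<close>. Since \<open>|d| \<le> |h| / R\<close>, the one-dimensional estimate applies,
  and replacing \<open>a + c\<close> by \<open>a\<close> costs only the relative error \<open>p c / a\<close>.\<close>

lemma profile_second_difference:
  fixes p :: real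
  assumes "p > 0"
  obtains C where "C > 0"
    "\<And>(x::'a::euclidean_space) h R. R > 0 \<Longrightarrow> norm h \<le> R / 2 \<Longrightarrow>
       \<bar>2 * profile p R x - profile p R (x + h) - profile p R (x - h)\<bar>
         \<le> C * (norm h / R)\<^sup>2 * profile p R x"
proof -
  obtain C where C: "C > 0"
    "\<And>d. \<bar>d\<bar> \<le> 1/2 \<Longrightarrow> \<bar>(1 + d) powr (-p) + (1 - d) powr (-p) - 2\<bar> \<le> C * d\<^sup>2"
    using powr_second_difference[OF assms] by blast
  show ?thesis
  proof
    show "2 * p + C > 0" using assms C by simp
    fix x h :: 'a and R :: real
    assume R: "R > 0" and h: "norm h \<le> R / 2"
    define a where "a = R\<^sup>2 + (norm x)\<^sup>2"
    define c where "c = (norm h)\<^sup>2"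
    define d where "d = 2 * (x \<bullet> h) / (a + c)"
    have a: "a > 0" "a \<ge> R\<^sup>2" "a \<ge> 2 * R * norm x" and c: "c \<ge> 0"
      using R sum_squares_bound[of R "norm x"] by (auto simp: a_def c_def add_pos_nonneg)
    have ac: "a + c > 0" using a c by simp
    have d: "\<bar>d\<bar> \<le> norm h / R"
    proof -
      have "\<bar>2 * (x \<bullet> h)\<bar> * R \<le> 2 * (norm x * norm h) * R"
        using Cauchy_Schwarz_ineq2[of x h] R by (intro mult_right_mono) auto
      also have "\<dots> = norm h * (2 * R * norm x)" by simp
      also have "\<dots> \<le> norm h * (a + c)" using a c by (intro mult_left_mono) auto
      finally show ?thesis using R ac by (simp add: d_def abs_mult field_simps)
    qed
    have "norm h / R \<le> 1/2" using h R by (simp add: field_simps)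
    then have d2: "\<bar>d\<bar> \<le> 1/2" using d by linarith
    have s1: "R\<^sup>2 + (norm (x + h))\<^sup>2 = (a + c) * (1 + d)"
      using ac by (simp add: a_def c_def d_def power2_norm_eq_inner inner_commute field_simps inner_add_left inner_add_right)
    have s2: "R\<^sup>2 + (norm (x - h))\<^sup>2 = (a + c) * (1 - d)"
      using ac by (simp add: a_def c_def d_def power2_norm_eq_inner inner_commute field_simps inner_diff_left inner_diff_right)
    have f1: "profile p R (x + h) = (a + c) powr (-p) * (1 + d) powr (-p)"
      unfolding profile_def s1 using ac d2 by (intro powr_mult; linarith)
    have f2: "profile p R (x - h) = (a + c) powr (-p) * (1 - d) powr (-p)"
      unfolding profile_def s2 using ac d2 by (intro powr_mult; linarith)
    have f0: "profile p R x = a powr (-p)" by (simp add: profile_def a_def)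
    have le: "(a + c) powr (-p) \<le> a powr (-p)"
      by (rule powr_mono2') (use a c assms in auto)
    have q: "c / a \<le> (norm h / R)\<^sup>2"
      unfolding power_divide c_def using a R by (intro divide_left_mono) auto
    have lo: "a powr (-p) - (a + c) powr (-p) \<le> p * (c / a) * a powr (-p)"
    proof -
      have "(a + c) powr (-p) = (a * (1 + c / a)) powr (-p)" using a by (simp add: distrib_left)
      also have "\<dots> = a powr (-p) * (1 + c / a) powr (-p)"
        by (rule powr_mult)
      finally have e: "(a + c) powr (-p) = a powr (-p) * (1 + c / a) powr (-p)" .
      have "1 - p * (c / a) \<le> 1 - p * ln (1 + c / a)"
        using assms a c mult_left_mono[OF ln_add_one_self_le_self[of "c / a"], of p] by simp
      also have "\<dots> \<le> exp (- p * ln (1 + c / a))"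
        using exp_ge_add_one_self[of "- p * ln (1 + c / a)"] by simp
      also have "\<dots> = (1 + c / a) powr (-p)" 
        using a c by (auto simp: powr_def add_nonneg_eq_0_iff)
      finally have "1 - (1 + c / a) powr (-p) \<le> p * (c / a)" by simp
      from mult_left_mono[OF this, of "a powr (-p)"] show ?thesis
        unfolding e by (simp add: algebra_simps)
    qed
    have "\<bar>2 * profile p R x - profile p R (x + h) - profile p R (x - h)\<bar>
      = \<bar>2 * (a powr (-p) - (a + c) powr (-p))
          - (a + c) powr (-p) * ((1 + d) powr (-p) + (1 - d) powr (-p) - 2)\<bar>"
      unfolding f0 f1 f2 by (simp add: algebra_simps)
    also have "\<dots> \<le> \<bar>2 * (a powr (-p) - (a + c) powr (-p))\<bar>
        + \<bar>(a + c) powr (-p) * ((1 + d) powr (-p) + (1 - d) powr (-p) - 2)\<bar>"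
      by (rule abs_triangle_ineq4)
    also have "\<dots> \<le> 2 * (p * (c / a) * a powr (-p)) + a powr (-p) * (C * d\<^sup>2)"
    proof (rule add_mono)
      show "\<bar>2 * (a powr (-p) - (a + c) powr (-p))\<bar> \<le> 2 * (p * (c / a) * a powr (-p))"
        using lo le by simp
      show "\<bar>(a + c) powr (-p) * ((1 + d) powr (-p) + (1 - d) powr (-p) - 2)\<bar>
        \<le> a powr (-p) * (C * d\<^sup>2)"
        unfolding abs_mult using le C(2)[OF d2] by (intro mult_mono) auto
    qed
    also have "\<dots> \<le> 2 * (p * (norm h / R)\<^sup>2 * a powr (-p)) + a powr (-p) * (C * (norm h / R)\<^sup>2)"
    proof -
      have "d\<^sup>2 \<le> (norm h / R)\<^sup>2" using d power_mono[of "\<bar>d\<bar>" "norm h / R" 2] by simp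
      then show ?thesis using q assms C(1)
        by (intro add_mono mult_left_mono mult_right_mono) auto
    qed
    also have "\<dots> = (2 * p + C) * (norm h / R)\<^sup>2 * profile p R x"
      unfolding f0 by (simp add: algebra_simps)
    finally show "\<bar>2 * profile p R x - profile p R (x + h) - profile p R (x - h)\<bar>
         \<le> (2 * p + C) * (norm h / R)\<^sup>2 * profile p R x" .
  qed
qed


section \<open>Powers of the distance over balls and their complements\<close>

text \<open>Both integrals of powers of the distance that are needed, over a ball and over the complement of
  a ball, are compared with a geometric series by covering the domain with shells of outer radius
  \<open>\<rho> * q ^ k\<close>: \<open>q = 1/2\<close> for the ball, \<open>q = 2\<close> for the complement. Every shell is estimated by the volume
  of the ball that contains it; the factor \<open>2 powr \<bar>s\<bar>\<close> accounts for the variation of the weight across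
  a shell, for either sign of \<open>s\<close>. The centre is left uncovered, as the weight is 0 there.\<close>

lemma nn_integral_dyadic_shells:
  fixes x :: "'a::euclidean_space" and S :: "'a set" and s q \<rho> :: real
  defines "n \<equiv> real DIM('a)"
  assumes S[measurable]: "S \<in> sets borel" and q: "0 < q" "q powr (n - s) < 1" and \<rho>: "0 < \<rho>"
    and shells: "\<And>z. z \<in> S \<Longrightarrow> z \<noteq> x \<Longrightarrow>
      \<exists>k::nat. \<rho> * q ^ k / 2 \<le> norm (x - z) \<and> norm (x - z) \<le> \<rho> * q ^ k"
  shows "(\<integral>\<^sup>+z. ennreal (indicator S z * norm (x - z) powr (-s)) \<partial>lborel)
    \<le> ennreal (2 powr \<bar>s\<bar> * unit_ball_vol n * \<rho> powr (n - s) / (1 - q powr (n - s)))"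
proof -
  define b where "b = (\<lambda>k::nat. \<rho> * q ^ k)"
  have b: "b k > 0" for k using q \<rho> by (simp add: b_def)
  define c where "c = (\<lambda>k. 2 powr \<bar>s\<bar> * b k powr (-s))"
  have c: "c k \<ge> 0" for k by (simp add: c_def)
  have point: "ennreal (indicator S z * norm (x - z) powr (-s))
      \<le> (\<Sum>k. ennreal (c k) * indicator (cball x (b k)) z)" for z
  proof (cases "z \<in> S \<and> z \<noteq> x")
    case True
    then obtain k where k: "b k / 2 \<le> norm (x - z)" "norm (x - z) \<le> b k"
      using shells by (auto simp: b_def)
    define d where "d = norm (x - z) / b k"
    have d: "1/2 \<le> d" "d \<le> 1" using k b[of k] by (auto simp: d_def field_simps)
    have "d powr (-s) \<le> 2 powr \<bar>s\<bar>"
    proof (cases "s \<ge> 0")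
      case True
      have "d powr (-s) \<le> (1/2) powr (-s)" by (rule powr_mono2') (use d True in auto)
      also have "\<dots> = 2 powr s" by (simp add: powr_divide powr_minus_divide[symmetric])
      finally show ?thesis using True by simp
    next
      case False
      have "d powr (-s) \<le> 1 powr (-s)" by (rule powr_mono2) (use d False in auto)
      also have "\<dots> \<le> 2 powr \<bar>s\<bar>" using ge_one_powr_ge_zero[of 2 "\<bar>s\<bar>"] by simp
      finally show ?thesis .
    qed
    moreover have "norm (x - z) powr (-s) = b k powr (-s) * d powr (-s)"
      using b[of k] by (subst powr_mult[symmetric]) (auto simp: d_def)
    ultimately have "norm (x - z) powr (-s) \<le> c k"
      using mult_right_mono[of "d powr (-s)" "2 powr \<bar>s\<bar>" "b k powr (-s)"] by (simp add: c_def mult.commute)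
    then have "ennreal (indicator S z * norm (x - z) powr (-s))
        \<le> ennreal (c k) * indicator (cball x (b k)) z"
      using True k by (auto simp: dist_norm intro!: ennreal_leI)
    also have "\<dots> = (\<Sum>j\<in>{k}. ennreal (c j) * indicator (cball x (b j)) z)"
      by (simp only: sum.insert finite.emptyI empty_iff not_False_eq_True sum.empty add_0_right)
    also have "\<dots> \<le> (\<Sum>k. ennreal (c k) * indicator (cball x (b k)) z)"
      by (rule sum_le_suminf) auto
    finally show ?thesis .
  next
    case False
    then show ?thesis by (auto simp: indicator_def)
  qed
  have shell: "ennreal (c k) * emeasure lborel (cball x (b k))
      = ennreal (2 powr \<bar>s\<bar> * unit_ball_vol n * \<rho> powr (n - s) * (q powr (n - s)) ^ k)" for k
  proof -
    have "b k ^ DIM('a) = b k powr n" using b[of k] by (simp add: n_def powr_realpow)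
    then have "b k powr (-s) * b k ^ DIM('a) = b k powr (n - s)"
      by (simp add: powr_add[symmetric] add.commute)
    also have "\<dots> = \<rho> powr (n - s) * (q powr (n - s)) ^ k"
      using q \<rho> by (simp add: b_def powr_mult powr_powr powr_realpow[symmetric] mult.commute)
    finally have *: "b k powr (-s) * b k ^ DIM('a) = \<rho> powr (n - s) * (q powr (n - s)) ^ k" .
    have "ennreal (c k) * emeasure lborel (cball x (b k))
       = ennreal (c k * (unit_ball_vol n * b k ^ DIM('a)))"
      using c b[of k] by (subst emeasure_cball) (auto simp: n_def ennreal_mult)
    also have "c k * (unit_ball_vol n * b k ^ DIM('a))
       = 2 powr \<bar>s\<bar> * unit_ball_vol n * (b k powr (-s) * b k ^ DIM('a))"
      by (simp add: c_def mult_ac)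
    finally show ?thesis unfolding * by (simp add: mult_ac)
  qed
  have "(\<integral>\<^sup>+z. ennreal (indicator S z * norm (x - z) powr (-s)) \<partial>lborel)
      \<le> (\<integral>\<^sup>+z. (\<Sum>k. ennreal (c k) * indicator (cball x (b k)) z) \<partial>lborel)"
    by (intro nn_integral_mono point)
  also have "\<dots> = (\<Sum>k. ennreal (c k) * emeasure lborel (cball x (b k)))"
  proof (subst nn_integral_suminf)
    show "(\<lambda>z. ennreal (c k) * indicator (cball x (b k)) z) \<in> borel_measurable lborel" for k
      by (intro borel_measurable_times_ennreal borel_measurable_const borel_measurable_indicator) simp
  qed (simp add: nn_integral_cmult_indicator)
  also have "\<dots> = (\<Sum>k. ennreal (2 powr \<bar>s\<bar> * unit_ball_vol n * \<rho> powr (n - s) * (q powr (n - s)) ^ k))"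
    by (simp only: shell)
  also have "\<dots> = ennreal (2 powr \<bar>s\<bar> * unit_ball_vol n * \<rho> powr (n - s) * (1 / (1 - q powr (n - s))))"
    by (intro suminf_ennreal_eq sums_mult geometric_sums) (use q in \<open>auto simp: n_def\<close>)
  finally show ?thesis by simp
qed

lemma set_integrable_LINT_le_of_nn_integral:
  fixes g :: "'a::euclidean_space \<Rightarrow> real"
  assumes [measurable]: "g \<in> borel_measurable borel" "S \<in> sets borel"
    and nonneg: "\<And>z. 0 \<le> g z" and "0 \<le> K"
    and le: "(\<integral>\<^sup>+z. ennreal (indicator S z * g z) \<partial>lborel) \<le> ennreal K"
  shows "set_integrable lborel S g" "(LINT z:S|lborel. g z) \<le> K"
proof -
  have i: "integrable lborel (\<lambda>z. indicator S z * g z)"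
  proof (rule integrableI_bounded)
    have "(\<integral>\<^sup>+z. ennreal (norm (indicator S z * g z)) \<partial>lborel)
      = (\<integral>\<^sup>+z. ennreal (indicator S z * g z) \<partial>lborel)"
      using nonneg by (auto intro!: nn_integral_cong simp: abs_mult)
    also have "\<dots> < \<infinity>" using le by (simp add: le_less_trans)
    finally show "(\<integral>\<^sup>+z. ennreal (norm (indicator S z * g z)) \<partial>lborel) < \<infinity>" .
  qed measurable
  then show "set_integrable lborel S g" by (simp add: set_integrable_def)
  have "ennreal (\<integral>z. indicator S z * g z \<partial>lborel) \<le> ennreal K"
    using le nonneg by (subst nn_integral_eq_integral[symmetric, OF i]) auto
  then show "(LINT z:S|lborel. g z) \<le> K"
    using \<open>0 \<le> K\<close> by (simp add: set_lebesgue_integral_def)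
qed

lemma dyadic_up:
  fixes t \<rho> :: real
  assumes "0 < \<rho>" "\<rho> < t"
  shows "\<exists>k::nat. 2 * \<rho> * 2 ^ k / 2 \<le> t \<and> t \<le> 2 * \<rho> * 2 ^ k"
proof -
  obtain k :: nat where k: "t / \<rho> < 2 ^ k" using real_arch_pow[of 2 "t/\<rho>"] by auto
  define m where "m = (LEAST k::nat. t \<le> 2 * \<rho> * 2 ^ k)"
  have ex: "t \<le> 2 * \<rho> * 2 ^ k" using k assms by (simp add: field_simps)
  have m: "t \<le> 2 * \<rho> * 2 ^ m" unfolding m_def by (rule LeastI[of _ k]) (rule ex)
  have "\<rho> * 2 ^ m \<le> t"
  proof (cases m)
    case 0 then show ?thesis using assms by simp
  next
    case (Suc j)
    have "\<not> t \<le> 2 * \<rho> * 2 ^ j" using not_less_Least[of j "\<lambda>k. t \<le> 2 * \<rho> * 2 ^ k"] Suc by (simp add: m_def)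
    then show ?thesis using Suc by simp
  qed
  with m show ?thesis by auto
qed

lemma dyadic_down:
  fixes t \<rho> :: real
  assumes "0 < t" "t \<le> \<rho>"
  shows "\<exists>k::nat. \<rho> * (1/2) ^ k / 2 \<le> t \<and> t \<le> \<rho> * (1/2) ^ k"
proof (cases "t = \<rho>")
  case False
  have "\<exists>k::nat. 2 * t * 2 ^ k / 2 \<le> \<rho> \<and> \<rho> \<le> 2 * t * 2 ^ k"
    using dyadic_up[of t \<rho>] assms False by auto
  then obtain k :: nat where "t * 2 ^ k \<le> \<rho>" "\<rho> \<le> 2 * t * 2 ^ k" by auto
  then have "\<rho> * (1/2) ^ k / 2 \<le> t \<and> t \<le> \<rho> * (1/2) ^ k" by (simp add: power_one_over field_simps)
  then show ?thesis ..
qed (use assms in \<open>auto intro!: exI[of _ 0]\<close>)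

lemma norm_powr_integrable_outside:
  fixes s :: real
  assumes s: "real DIM('a::euclidean_space) < s"
  obtains C where "C > 0"
    "\<And>(x::'a) \<rho>. \<rho> > 0 \<Longrightarrow> set_integrable lborel {z. \<rho> < norm (x - z)} (\<lambda>z. norm (x - z) powr (-s))"
    "\<And>(x::'a) \<rho>. \<rho> > 0 \<Longrightarrow> (LINT z:{z. \<rho> < norm (x - z)}|lborel. norm (x - z) powr (-s))
        \<le> C * \<rho> powr (real DIM('a) - s)"
proof -
  define n where "n = real DIM('a)"
  have q: "2 powr (n - s) < 1" using s using powr_less_mono[of "n - s" 0 2] by (simp add: n_def)
  define C where "C = 2 powr \<bar>s\<bar> * unit_ball_vol n * 2 powr (n - s) / (1 - 2 powr (n - s))"
  have C: "C > 0" using q by (simp add: C_def n_def)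
  have le: "(\<integral>\<^sup>+z. ennreal (indicator {z. \<rho> < norm (x - z)} z * norm (x - z) powr (-s)) \<partial>lborel)
      \<le> ennreal (C * \<rho> powr (n - s))" if "\<rho> > 0" for x :: 'a and \<rho>
  proof -
    have "(\<integral>\<^sup>+z. ennreal (indicator {z. \<rho> < norm (x - z)} z * norm (x - z) powr (-s)) \<partial>lborel)
      \<le> ennreal (2 powr \<bar>s\<bar> * unit_ball_vol (real DIM('a)) * (2 * \<rho>) powr (real DIM('a) - s) /
           (1 - 2 powr (real DIM('a) - s)))"
      by (rule nn_integral_dyadic_shells)
        (use q that dyadic_up[of \<rho>] in \<open>auto simp: n_def intro!: borel_open open_Collect_less continuous_intros\<close>)
    then show ?thesis by (simp add: C_def n_def powr_mult mult_ac)
  qed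
  have m: "(\<lambda>z. norm (x - z) powr (-s)) \<in> borel_measurable borel" 
     "{z. \<rho> < norm (x - z)} \<in> sets borel" for x :: 'a and \<rho> by measurable
  show ?thesis
  proof (rule that[OF C])
    fix x :: 'a and \<rho> :: real assume r: "\<rho> > 0"
    note * = set_integrable_LINT_le_of_nn_integral[OF m _ _ le[OF r]]
    show "set_integrable lborel {z. \<rho> < norm (x - z)} (\<lambda>z. norm (x - z) powr (-s))"
      by (rule *(1)) (use C in auto)
    show "(LINT z:{z. \<rho> < norm (x - z)}|lborel. norm (x - z) powr (-s)) \<le> C * \<rho> powr (real DIM('a) - s)"
      unfolding n_def[symmetric] by (rule *(2)) (use C in auto)
  qed
qed

lemma norm_powr_integrable_inside:
  fixes s :: real
  assumes s: "s < real DIM('a::euclidean_space)"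
  obtains C where "C > 0"
    "\<And>(x::'a) \<rho>. \<rho> > 0 \<Longrightarrow> set_integrable lborel (cball x \<rho>) (\<lambda>z. norm (x - z) powr (-s))"
    "\<And>(x::'a) \<rho>. \<rho> > 0 \<Longrightarrow> (LINT z:cball x \<rho>|lborel. norm (x - z) powr (-s))
        \<le> C * \<rho> powr (real DIM('a) - s)"
proof -
  define n where "n = real DIM('a)"
  have q: "(1/2) powr (n - s) < 1" using s
    by (simp add: n_def powr_divide field_simps)
  define C where "C = 2 powr \<bar>s\<bar> * unit_ball_vol n / (1 - (1/2) powr (n - s))"
  have C: "C > 0" using q by (simp add: C_def n_def)
  have le: "(\<integral>\<^sup>+z. ennreal (indicator (cball x \<rho>) z * norm (x - z) powr (-s)) \<partial>lborel)
      \<le> ennreal (C * \<rho> powr (n - s))" if "\<rho> > 0" for x :: 'a and \<rho>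
  proof -
    have "(\<integral>\<^sup>+z. ennreal (indicator (cball x \<rho>) z * norm (x - z) powr (-s)) \<partial>lborel)
      \<le> ennreal (2 powr \<bar>s\<bar> * unit_ball_vol (real DIM('a)) * \<rho> powr (real DIM('a) - s) /
           (1 - (1/2) powr (real DIM('a) - s)))"
      by (rule nn_integral_dyadic_shells)
        (use q that dyadic_down[of _ \<rho>] in \<open>auto simp: n_def dist_norm\<close>)
    then show ?thesis by (simp add: C_def n_def mult_ac)
  qed
  have m: "(\<lambda>z. norm (x - z) powr (-s)) \<in> borel_measurable borel" 
     "cball x \<rho> \<in> sets borel" for x :: 'a and \<rho> by measurable
  show ?thesis
  proof (rule that[OF C])
    fix x :: 'a and \<rho> :: real assume r: "\<rho> > 0"
    note * = set_integrable_LINT_le_of_nn_integral[OF m _ _ le[OF r]]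
    show "set_integrable lborel (cball x \<rho>) (\<lambda>z. norm (x - z) powr (-s))"
      by (rule *(1)) (use C in auto)
    show "(LINT z:cball x \<rho>|lborel. norm (x - z) powr (-s)) \<le> C * \<rho> powr (real DIM('a) - s)"
      unfolding n_def[symmetric] by (rule *(2)) (use C in auto)
  qed
qed


section \<open>The truncated fractional Laplacian of the algebraic profile\<close>

lemma profile_pos: "R > 0 \<Longrightarrow> 0 < profile p R x"
  by (simp add: profile_def add_pos_nonneg pos_add_strict powr_gt_zero less_imp_neq)

lemma continuous_profile [continuous_intros]:
  fixes g :: "'b::topological_space \<Rightarrow> 'a::real_normed_vector"
  assumes "R > 0" "continuous_on S g"
  shows "continuous_on S (\<lambda>t. profile p R (g t))"
  unfolding profile_def
  by (intro continuous_intros assms) (use assms(1) in \<open>auto simp: add_pos_nonneg less_imp_neq[symmetric] zero_less_power sum_power2_eq_zero_iff\<close>)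

lemma borel_measurable_profile [measurable]:
  "profile p R \<in> borel_measurable (borel :: 'a::euclidean_space measure)"
  unfolding profile_def by measurable

lemma profile_le: "R > 0 \<Longrightarrow> p > 0 \<Longrightarrow> profile p R x \<le> R powr (- 2 * p)"
proof -
  assume R: "R > 0" and p: "p > 0"
  have "profile p R x \<le> (R\<^sup>2) powr (-p)"
    unfolding profile_def by (rule powr_mono2') (use R p in auto)
  also have "\<dots> = R powr (-2 * p)" using R by (simp add: powr_powr flip: powr_numeral)
  finally show ?thesis .
qed

text \<open>The profile is at most \<open>R powr (-2 * p)\<close>, and at most \<open>|z| powr (-2 * p)\<close>; the first bound is
  integrated over the ball of radius \<open>R\<close> and the second one over its complement. Both give the same power
  of \<open>R\<close>.\<close>

lemma profile_integral:
  assumes p: "real DIM('a::euclidean_space) < 2 * p"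
  obtains C where "C > 0"
    "\<And>R. R > 0 \<Longrightarrow> integrable lborel (profile p R :: 'a \<Rightarrow> real)"
    "\<And>R. R > 0 \<Longrightarrow> (\<integral>z. profile p R (z::'a) \<partial>lborel) \<le> C * R powr (real DIM('a) - 2 * p)"
proof -
  define n where "n = real DIM('a)"
  have p0: "p > 0" using p by (smt (verit) of_nat_0_le_iff)
  obtain C where C: "C > 0"
    "\<And>(x::'a) \<rho>. \<rho> > 0 \<Longrightarrow> set_integrable lborel {z. \<rho> < norm (x - z)} (\<lambda>z. norm (x - z) powr (-(2*p)))"
    "\<And>(x::'a) \<rho>. \<rho> > 0 \<Longrightarrow> (LINT z:{z. \<rho> < norm (x - z)}|lborel. norm (x - z) powr (-(2*p)))
        \<le> C * \<rho> powr (real DIM('a) - 2*p)"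
    using norm_powr_integrable_outside[OF p] by blast
  have main: "integrable lborel (profile p R :: 'a \<Rightarrow> real) \<and>
     (\<integral>z. profile p R (z::'a) \<partial>lborel) \<le> (unit_ball_vol n + C) * R powr (n - 2 * p)"
    if R: "R > 0" for R
  proof -
    define g where "g = (\<lambda>z::'a. R powr (-2 * p) * indicator (cball 0 R) z
      + indicator {z. R < norm (0 - z)} z * norm (0 - z) powr (-(2*p)))"
    have i1: "integrable lborel (\<lambda>z::'a. R powr (-2 * p) * indicator (cball 0 R) z)"
      by (intro integrable_mult_right integrable_real_indicator) (auto simp: emeasure_cball less_imp_le R)
    have i2: "integrable lborel (\<lambda>z::'a. indicator {z. R < norm (0 - z)} z * norm (0 - z) powr (-(2*p)))"
      using C(2)[OF R, of 0] by (simp add: set_integrable_def)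
    have ig: "integrable lborel g" unfolding g_def by (intro Bochner_Integration.integrable_add i1 i2)
    have le: "profile p R z \<le> g z" for z :: 'a
    proof (cases "norm z \<le> R")
      case True
      then show ?thesis using profile_le[OF R p0, of z] by (simp add: g_def)
    next
      case False
      have "profile p R z \<le> ((norm z)\<^sup>2) powr (-p)"
        unfolding profile_def by (rule powr_mono2') (use False R p0 in auto)
      also have "\<dots> = norm z powr (-(2*p))" 
        using False R by (simp add: powr_powr flip: powr_numeral)
      finally show ?thesis using False by (simp add: g_def)
    qed
    have ip: "integrable lborel (profile p R :: 'a \<Rightarrow> real)"
    proof (rule Bochner_Integration.integrable_bound[OF ig])
      have "norm (profile p R z) \<le> norm (g z)" for z
        using le[of z] profile_pos[OF R, of p z] by simp
      then show "AE z in lborel. norm (profile p R z) \<le> norm (g z)" by simp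
    qed measurable
    have Rn: "R powr (-2 * p) * R ^ DIM('a) = R powr (n - 2 * p)"
      using R by (simp add: n_def powr_realpow[symmetric] powr_add[symmetric] algebra_simps)
    have "(\<integral>z. profile p R (z::'a) \<partial>lborel) \<le> (\<integral>z. g z \<partial>lborel)"
      by (rule integral_mono[OF ip ig le])
    also have "\<dots> = (\<integral>z. R powr (-2 * p) * indicator (cball (0::'a) R) z \<partial>lborel)
        + (\<integral>z. indicator {z. R < norm (0 - z)} z * norm ((0::'a) - z) powr (-(2*p)) \<partial>lborel)"
      unfolding g_def by (rule Bochner_Integration.integral_add[OF i1 i2])
    also have "(\<integral>z. R powr (-2 * p) * indicator (cball (0::'a) R) z \<partial>lborel)
       = unit_ball_vol n * R powr (n - 2 * p)"
      using R Rn by (simp add: content_cball n_def) 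
    also have "(\<integral>z. indicator {z. R < norm (0 - z)} z * norm ((0::'a) - z) powr (-(2*p)) \<partial>lborel)
       \<le> C * R powr (n - 2 * p)"
      using C(3)[OF R, of 0] by (simp add: set_lebesgue_integral_def n_def)
    finally show ?thesis using ip by (simp add: algebra_simps)
  qed
  show ?thesis
    by (rule that[of "unit_ball_vol n + C"]) (use main C(1) in \<open>auto simp: n_def add_nonneg_pos\<close>)
qed

lemma lborel_distr_reflect:
  "distr lborel borel (\<lambda>z. t - z) = (lborel :: 'a::euclidean_space measure)"
  by (subst lborel_affine[of "-1" t]) (auto simp: density_1 one_ennreal_def[symmetric])

lemma set_integrable_divide_norm_powr_outside:
  fixes g :: "'a::euclidean_space \<Rightarrow> real"
  assumes [measurable]: "g \<in> borel_measurable borel" and K: "\<And>z. \<bar>g z\<bar> \<le> K"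
    and s: "real DIM('a) < s" and r: "0 < r"
  shows "set_integrable lborel {z. r < norm (x - z)} (\<lambda>z. g z / norm (x - z) powr s)"
proof -
  have "set_integrable lborel {z. r < norm (x - z)} (\<lambda>z. norm (x - z) powr (-s))"
    using norm_powr_integrable_outside[OF s] r by metis
  then have "set_integrable lborel {z. r < norm (x - z)} (\<lambda>z. K * norm (x - z) powr (-s))"
    by (rule set_integrable_mult_right)
  then show ?thesis
  proof (rule set_integrable_bound)
    show "set_borel_measurable lborel {z. r < norm (x - z)} (\<lambda>z. g z / norm (x - z) powr s)"
      unfolding set_borel_measurable_def by measurable
    have "0 \<le> K" using K[of 0] by linarith
    then show "AE z in lborel. z \<in> {z. r < norm (x - z)} \<longrightarrow>
        norm (g z / norm (x - z) powr s) \<le> norm (K * norm (x - z) powr (-s))"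
      using K by (auto simp: powr_minus divide_inverse abs_mult intro!: mult_right_mono)
  qed
qed


text \<open>The integral is split at distance \<open>\<rho> = R / 2\<close>. Near \<open>x\<close>, the reflection \<open>z \<mapsto> 2 x - z\<close> turns the
  difference into a second difference, of order \<open>(|x - z| / R)\<^sup>2\<close> relative to the profile at \<open>x\<close>; this
  makes the singularity integrable, uniformly in \<open>r\<close>. Far from \<open>x\<close>, either \<open>|z| \<ge> |x| / 2\<close>, and then
  the profile at \<open>z\<close> is comparable to the one at \<open>x\<close>, or \<open>|x - z| > |x| / 2\<close>, and then the kernel itself is at
  most a multiple of the profile at \<open>x\<close>. In the second case the remaining factor is the integral of the
  profile. All three contributions carry the factor \<open>R powr (- 2 * \<alpha>)\<close>.\<close>

lemma profile_nonlocal_bound: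
  fixes \<alpha> :: real
  assumes \<alpha>: "0 < \<alpha>" "\<alpha> < 1"
  defines "n \<equiv> real DIM('a::euclidean_space)"
  defines "p \<equiv> (n + 2 * \<alpha>) / 2"
  obtains C where "C > 0"
    "\<And>(x::'a) R r. 0 < r \<Longrightarrow> r < R / 2 \<Longrightarrow>
      \<bar>LINT z:{z. r < norm (x - z)}|lborel. (profile p R x - profile p R z) / norm (x - z) powr (n + 2 * \<alpha>)\<bar>
        \<le> C * R powr (-2 * \<alpha>) * profile p R x"
proof -
  define s where "s = n + 2 * \<alpha>"
  have s: "n < s" "s - 2 < n" "s = 2 * p" using \<alpha> by (auto simp: s_def p_def)
  have p: "p > 0" using \<alpha> by (simp add: p_def n_def add_nonneg_pos)
  obtain C1 where C1: "C1 > 0"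
    "\<And>(x::'a) h R. R > 0 \<Longrightarrow> norm h \<le> R / 2 \<Longrightarrow>
       \<bar>2 * profile p R x - profile p R (x + h) - profile p R (x - h)\<bar>
         \<le> C1 * (norm h / R)\<^sup>2 * profile p R x"
    using profile_second_difference[OF p, where 'a = 'a] by blast
  obtain C2 where C2: "C2 > 0"
    "\<And>(x::'a) \<rho>. \<rho> > 0 \<Longrightarrow> set_integrable lborel (cball x \<rho>) (\<lambda>z. norm (x - z) powr (-(s - 2)))"
    "\<And>(x::'a) \<rho>. \<rho> > 0 \<Longrightarrow> (LINT z:cball x \<rho>|lborel. norm (x - z) powr (-(s - 2)))
        \<le> C2 * \<rho> powr (n - (s - 2))"
    using norm_powr_integrable_inside[of "s - 2", where 'a = 'a] s(2) unfolding n_def by blast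
  obtain C3 where C3: "C3 > 0"
    "\<And>(x::'a) \<rho>. \<rho> > 0 \<Longrightarrow> set_integrable lborel {z. \<rho> < norm (x - z)} (\<lambda>z. norm (x - z) powr (-s))"
    "\<And>(x::'a) \<rho>. \<rho> > 0 \<Longrightarrow> (LINT z:{z. \<rho> < norm (x - z)}|lborel. norm (x - z) powr (-s))
        \<le> C3 * \<rho> powr (n - s)"
    using norm_powr_integrable_outside[of s, where 'a = 'a] s(1) unfolding n_def by blast
  obtain C4 where C4: "C4 > 0"
    "\<And>R. R > 0 \<Longrightarrow> integrable lborel (profile p R :: 'a \<Rightarrow> real)"
    "\<And>R. R > 0 \<Longrightarrow> (\<integral>z. profile p R (z::'a) \<partial>lborel) \<le> C4 * R powr (n - s)"
    using profile_integral[of p, where 'a = 'a] s unfolding n_def by metis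
  define K1 where "K1 = C1 * C2 * (1/2) powr (2 - 2*\<alpha>)"
  define K2 where "K2 = 2 * 8 powr p * (C3 * (1/2) powr (-2*\<alpha>) + C4)"
  have K: "K1 > 0" "K2 > 0"
    unfolding K1_def K2_def using C1 C2 C3 C4 by (auto intro!: mult_pos_pos add_pos_pos)
  show ?thesis
  proof (rule that[of "K1 + K2"])
    show "K1 + K2 > 0" using K by simp
    fix x :: 'a and R r :: real
    assume r: "0 < r" "r < R / 2"
    define \<rho> where "\<rho> = R / 2"
    have R: "R > 0" "\<rho> > 0" "r < \<rho>" using r by (auto simp: \<rho>_def)
    define \<phi> where "\<phi> = (profile p R :: 'a \<Rightarrow> real)"
    have \<phi>_pos: "\<phi> z > 0" for z using profile_pos[OF R(1)] by (simp add: \<phi>_def)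
    have \<phi>_meas[measurable]: "\<phi> \<in> borel_measurable borel" unfolding \<phi>_def by measurable
    define F where "F = (\<lambda>z. (\<phi> x - \<phi> z) / norm (x - z) powr s)"
    define A where "A = {z. r < norm (x - z) \<and> norm (x - z) \<le> \<rho>}"
    define B where "B = {z. \<rho> < norm (x - z)}"
    have [measurable]: "A \<in> sets borel" "B \<in> sets borel" unfolding A_def B_def by measurable
    have F_meas[measurable]: "F \<in> borel_measurable borel" unfolding F_def by measurable
    have AB: "{z. r < norm (x - z)} = A \<union> B" "A \<inter> B = {}"
      using R by (auto simp: A_def B_def)
    have iF: "set_integrable lborel {z. r < norm (x - z)} F"
      unfolding F_def
    proof (rule set_integrable_divide_norm_powr_outside)
      show "\<bar>\<phi> x - \<phi> z\<bar> \<le> R powr (-2*p) + R powr (-2*p)" for z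
        using \<phi>_pos[of x] \<phi>_pos[of z] profile_le[OF R(1) p, of x] profile_le[OF R(1) p, of z]
        unfolding \<phi>_def by linarith
    qed (use s r in \<open>auto simp: n_def\<close>)
    have iA: "set_integrable lborel A F" and iB: "set_integrable lborel B F"
      by (rule set_integrable_subset[OF iF]; use AB in auto)+
    have split: "(LINT z:{z. r < norm (x - z)}|lborel. F z) = (LINT z:A|lborel. F z) + (LINT z:B|lborel. F z)"
      unfolding AB(1) by (rule set_integral_Un[OF AB(2) iA iB])
    have bA: "\<bar>LINT z:A|lborel. F z\<bar> \<le> K1 * R powr (-2*\<alpha>) * \<phi> x"
    proof -
      define G where "G = (\<lambda>z. indicator A z * F z)"
      have G[measurable]: "G \<in> borel_measurable borel" unfolding G_def by measurable
      have iG: "integrable lborel G" using iA by (simp add: G_def set_integrable_def)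
      \<comment> \<open>the reflected integrand, with the same integral since the annulus is symmetric about \<open>x\<close>\<close>
      define G' where "G' = (\<lambda>z. G (2 *\<^sub>R x - z))"
      have iG': "integrable lborel G'"
        unfolding G'_def
        using iG integrable_distr_eq[of "\<lambda>z. 2 *\<^sub>R x - z" lborel borel G]
        by (simp add: lborel_distr_reflect)
      have eG': "(\<integral>z. G' z \<partial>lborel) = (\<integral>z. G z \<partial>lborel)"
        unfolding G'_def
        using integral_distr[of "\<lambda>z. 2 *\<^sub>R x - z" lborel borel G]
        by (simp add: lborel_distr_reflect)
      define H where "H = (\<lambda>z. indicator (cball x \<rho>) z * norm (x - z) powr (-(s - 2)))"
      have iH: "integrable lborel H" using C2(2)[OF R(2), of x] by (simp add: H_def set_integrable_def)
      have point: "\<bar>G z + G' z\<bar> \<le> C1 / R\<^sup>2 * \<phi> x * H z" for z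
      proof (cases "z \<in> A")
        case True
        define h where "h = z - x"
        have z: "z = x + h" "2 *\<^sub>R x - z = x - h" by (auto simp: h_def scaleR_2)
        have h: "r < norm h" "norm h \<le> \<rho>" using True by (auto simp: A_def h_def norm_minus_commute)
        have A: "x - h \<in> A" "x + h \<in> A" using h by (auto simp: A_def)
        have e: "G z + G' z = (2 * \<phi> x - \<phi> (x + h) - \<phi> (x - h)) / norm h powr s"
          unfolding G'_def z(2) unfolding z(1) using A by (simp add: G_def F_def z add_divide_distrib[symmetric])
        have "\<bar>G z + G' z\<bar> = \<bar>2 * \<phi> x - \<phi> (x + h) - \<phi> (x - h)\<bar> / norm h powr s"
          unfolding e by (simp add: abs_divide)
        also have "\<dots> \<le> (C1 * (norm h / R)\<^sup>2 * \<phi> x) / norm h powr s"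
          unfolding \<phi>_def by (intro divide_right_mono C1(2)) (use R h in \<open>auto simp: \<rho>_def\<close>)
        also have "\<dots> = C1 / R\<^sup>2 * \<phi> x * ((norm h)\<^sup>2 / norm h powr s)"
          by (simp add: power_divide)
        also have "(norm h)\<^sup>2 / norm h powr s = norm h powr (-(s - 2))"
        proof -
          have "norm h > 0" using h r by linarith
          then show ?thesis by (simp add: powr_diff)
        qed
        also have "norm h powr (-(s - 2)) = H z"
          using h by (simp add: H_def h_def dist_norm norm_minus_commute)
        finally show ?thesis .
      next
        case False
        have "x - (2 *\<^sub>R x - z) = - (x - z)" by (simp add: scaleR_2)
        then have "norm (x - (2 *\<^sub>R x - z)) = norm (x - z)" by (metis norm_minus_cancel)
        then have "2 *\<^sub>R x - z \<notin> A" using False by (auto simp: A_def)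
        then have "G z + G' z = 0" using False by (simp add: G_def G'_def)
        then show ?thesis using C1(1) \<phi>_pos[of x] by (simp add: H_def)
      qed
      have "2 * (\<integral>z. G z \<partial>lborel) = (\<integral>z. G z + G' z \<partial>lborel)"
        using Bochner_Integration.integral_add[OF iG iG'] eG' by simp
      also have "\<bar>\<dots>\<bar> \<le> (\<integral>z. C1 / R\<^sup>2 * \<phi> x * H z \<partial>lborel)"
        using Bochner_Integration.integral_norm_bound_integral[of lborel "\<lambda>z. G z + G' z" "\<lambda>z. C1 / R\<^sup>2 * \<phi> x * H z"] iG iG' iH point
        by simp
      also have "\<dots> = C1 / R\<^sup>2 * \<phi> x * (\<integral>z. H z \<partial>lborel)" by simp
      also have "\<dots> \<le> C1 / R\<^sup>2 * \<phi> x * (C2 * \<rho> powr (n - (s - 2)))"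
        using C2(3)[OF R(2), of x] C1(1) \<phi>_pos[of x]
        by (intro mult_left_mono) (auto simp: H_def set_lebesgue_integral_def)
      also have "\<dots> = K1 * \<phi> x * (R powr (2 - 2 * \<alpha>) / R\<^sup>2)"
      proof -
        have e1: "n - (s - 2) = 2 - 2 * \<alpha>" by (simp add: s_def)
        have e2: "\<rho> powr (2 - 2 * \<alpha>) = (1/2) powr (2 - 2 * \<alpha>) * R powr (2 - 2 * \<alpha>)"
          by (simp add: \<rho>_def powr_mult[symmetric])
        show ?thesis unfolding e1 e2 by (simp add: K1_def)
      qed
      also have "R powr (2 - 2 * \<alpha>) / R\<^sup>2 = R powr (-2 * \<alpha>)"
        using R by (simp add: powr_diff powr_minus divide_inverse)
      finally have "\<bar>2 * (\<integral>z. G z \<partial>lborel)\<bar> \<le> K1 * \<phi> x * R powr (-2*\<alpha>)" .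
      moreover have "(LINT z:A|lborel. F z) = (\<integral>z. G z \<partial>lborel)"
        by (simp add: G_def set_lebesgue_integral_def)
      ultimately show ?thesis by (simp add: abs_mult mult_ac)
    qed
    have bB: "\<bar>LINT z:B|lborel. F z\<bar> \<le> K2 * R powr (-2*\<alpha>) * \<phi> x"
    proof -
      define k where "k = (\<lambda>z. indicator B z * norm (x - z) powr (-s))"
      have ik: "integrable lborel k" using C3(2)[OF R(2), of x] by (simp add: k_def B_def set_integrable_def)
      have i\<phi>: "integrable lborel \<phi>" using C4(2)[OF R(1)] by (simp add: \<phi>_def)
      have e8: "1 \<le> 8 powr p" using p ge_one_powr_ge_zero[of 8 p] by simp
      have pd: "((R\<^sup>2 + (norm x)\<^sup>2) / 8) powr (-p) = 8 powr p * \<phi> x"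
        unfolding \<phi>_def profile_def by (rule powr_neg_quotient)
      have point: "\<bar>indicator B z * F z\<bar> \<le> 2 * 8 powr p * \<phi> x * (k z + \<phi> z)" for z
      proof (cases "z \<in> B")
        case True
        have zB: "norm (x - z) > R / 2" using True by (simp add: B_def \<rho>_def)
        have kz: "k z = norm (x - z) powr (-s)" using True by (simp add: k_def)
        have k0: "k z \<ge> 0" by (simp add: k_def)
        \<comment> \<open>the product of the profile and the kernel is controlled by the sum of the two\<close>
        have *: "\<phi> z * k z \<le> 8 powr p * \<phi> x * (k z + \<phi> z)"
        proof (cases "norm z \<ge> norm x / 2")
          case True
          have "\<phi> z \<le> ((R\<^sup>2 + (norm x)\<^sup>2) / 8) powr (-p)"
            unfolding \<phi>_def profile_def
          proof (rule powr_mono2')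
            have "(norm x / 2)\<^sup>2 \<le> (norm z)\<^sup>2" using True by (intro power_mono) auto
            then have "(norm x)\<^sup>2 / 4 \<le> (norm z)\<^sup>2" by (simp add: power_divide)
            then show "(R\<^sup>2 + (norm x)\<^sup>2) / 8 \<le> R\<^sup>2 + (norm z)\<^sup>2"
              unfolding add_divide_distrib
              using zero_le_power2[of R] zero_le_power2[of "norm z"] by linarith
          qed (use R p in \<open>auto simp: add_pos_nonneg\<close>)
          also have "\<dots> = 8 powr p * \<phi> x"
            by (rule pd)
          finally have "\<phi> z * k z \<le> 8 powr p * \<phi> x * k z" using k0 by (rule mult_right_mono)
          also have "\<dots> \<le> 8 powr p * \<phi> x * (k z + \<phi> z)"
            using \<phi>_pos[of x] \<phi>_pos[of z] by (intro mult_left_mono) auto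
          finally show ?thesis .
        next
          case False
          have x: "norm x \<le> norm (x - z) + norm z" by (metis norm_triangle_sub add.commute)
          then have "norm (x - z) > norm x / 2" using False by linarith
          then have "(norm x / 2)\<^sup>2 \<le> (norm (x - z))\<^sup>2" by (intro power_mono) auto
          moreover have "(R / 2)\<^sup>2 \<le> (norm (x - z))\<^sup>2" using zB R by (intro power_mono) auto
          ultimately have ge: "(R\<^sup>2 + (norm x)\<^sup>2) / 8 \<le> (norm (x - z))\<^sup>2"
            by (simp add: power_divide)
          have nz: "norm (x - z) > 0" using zB R by linarith
          have "k z = ((norm (x - z))\<^sup>2) powr (-p)"
            unfolding kz s(3) using nz by (simp add: powr_powr flip: powr_numeral)
          also have "\<dots> \<le> ((R\<^sup>2 + (norm x)\<^sup>2) / 8) powr (-p)"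
            by (rule powr_mono2') (use ge R p in \<open>auto simp: add_pos_nonneg\<close>)
          also have "\<dots> = 8 powr p * \<phi> x"
            by (rule pd)
          finally have "k z * \<phi> z \<le> 8 powr p * \<phi> x * \<phi> z" using \<phi>_pos[of z] by (intro mult_right_mono) auto
          also have "\<dots> \<le> 8 powr p * \<phi> x * (k z + \<phi> z)"
            using \<phi>_pos[of x] k0 by (intro mult_left_mono) auto
          finally show ?thesis by (simp add: mult.commute)
        qed
        have "\<phi> x * k z \<le> (8 powr p * \<phi> x) * (k z + \<phi> z)"
        proof (rule mult_mono)
          show "\<phi> x \<le> 8 powr p * \<phi> x" using mult_right_mono[OF e8, of "\<phi> x"] \<phi>_pos[of x] by simp
        qed (use k0 \<phi>_pos[of x] \<phi>_pos[of z] in auto)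
        moreover have "\<bar>indicator B z * F z\<bar> \<le> (\<phi> x + \<phi> z) * k z"
        proof -
          have "\<bar>indicator B z * F z\<bar> = \<bar>\<phi> x - \<phi> z\<bar> * k z"
            using True by (simp add: F_def kz abs_divide powr_minus divide_inverse abs_mult)
          also have "\<dots> \<le> (\<phi> x + \<phi> z) * k z"
            using \<phi>_pos[of x] \<phi>_pos[of z] k0 by (intro mult_right_mono) auto
          finally show ?thesis .
        qed
        ultimately show ?thesis using * by (simp add: distrib_right)
      next
        case False
        then show ?thesis using \<phi>_pos[of x] \<phi>_pos[of z] by (simp add: k_def less_imp_le)
      qed
      have "\<bar>LINT z:B|lborel. F z\<bar> = \<bar>\<integral>z. indicator B z * F z \<partial>lborel\<bar>"
        by (simp add: set_lebesgue_integral_def)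
      also have "\<dots> \<le> (\<integral>z. 2 * 8 powr p * \<phi> x * (k z + \<phi> z) \<partial>lborel)"
        using Bochner_Integration.integral_norm_bound_integral[of lborel "\<lambda>z. indicator B z * F z"
            "\<lambda>z. 2 * 8 powr p * \<phi> x * (k z + \<phi> z)"] iB ik i\<phi> point
        by (simp add: set_integrable_def)
      also have "\<dots> = 2 * 8 powr p * \<phi> x * ((\<integral>z. k z \<partial>lborel) + (\<integral>z. \<phi> z \<partial>lborel))"
        using ik i\<phi> by simp
      also have "\<dots> \<le> 2 * 8 powr p * \<phi> x * (C3 * \<rho> powr (n - s) + C4 * R powr (n - s))"
        using C3(3)[OF R(2), of x] C4(3)[OF R(1)] \<phi>_pos[of x]
        by (intro mult_left_mono add_mono) (auto simp: k_def B_def \<phi>_def set_lebesgue_integral_def)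
      also have "\<dots> = K2 * R powr (-2*\<alpha>) * \<phi> x"
      proof -
        have e1: "n - s = -2 * \<alpha>" by (simp add: s_def)
        have e2: "\<rho> powr (-2 * \<alpha>) = (1/2) powr (-2 * \<alpha>) * R powr (-2 * \<alpha>)"
          by (simp add: \<rho>_def powr_mult[symmetric])
        show ?thesis unfolding e1 e2 K2_def by (simp add: algebra_simps)
      qed
      finally show ?thesis .
    qed
    show "\<bar>LINT z:{z. r < norm (x - z)}|lborel.
        (profile p R x - profile p R z) / norm (x - z) powr (n + 2 * \<alpha>)\<bar>
        \<le> (K1 + K2) * R powr (-2 * \<alpha>) * profile p R x"
    proof -
      have "\<bar>LINT z:{z. r < norm (x - z)}|lborel. F z\<bar>
          \<le> K1 * R powr (-2*\<alpha>) * \<phi> x + K2 * R powr (-2*\<alpha>) * \<phi> x"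
        using bA bB unfolding split by linarith
      also have "\<dots> = (K1 + K2) * R powr (-2*\<alpha>) * \<phi> x" by (simp only: distrib_right)
      finally show ?thesis unfolding F_def \<phi>_def s_def .
    qed
  qed
qed


section \<open>Size of the two factors of the barrier\<close>

lemma profile_lower:
  assumes "R \<ge> 1" "p > 0"
  shows "R powr (- 2 * p) * (1 + norm x) powr (- 2 * p) \<le> profile p R x"
proof -
  have e: "w powr (- 2 * p) = (w\<^sup>2) powr (-p)" if "w > 0" for w :: real
    using that by (simp add: powr_powr flip: powr_numeral)
  have "R\<^sup>2 + (norm x)\<^sup>2 \<le> (R * (1 + norm x))\<^sup>2"
  proof -
    have "1 \<le> R\<^sup>2" using assms by simp
    then have "(norm x)\<^sup>2 \<le> R\<^sup>2 * (norm x)\<^sup>2" using mult_right_mono[of 1 "R\<^sup>2" "(norm x)\<^sup>2"] by simp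
    moreover have "0 \<le> R\<^sup>2 * (2 * norm x)" by simp
    moreover have "(R * (1 + norm x))\<^sup>2 = R\<^sup>2 + R\<^sup>2 * (2 * norm x) + R\<^sup>2 * (norm x)\<^sup>2"
      by (simp add: power2_eq_square algebra_simps)
    ultimately show ?thesis by linarith
  qed
  then have "((R * (1 + norm x))\<^sup>2) powr (-p) \<le> profile p R x"
    unfolding profile_def by (intro powr_mono2') (use assms in \<open>auto simp: add_pos_nonneg\<close>)
  moreover have "((R * (1 + norm x))\<^sup>2) powr (-p) = (R * (1 + norm x)) powr (- 2 * p)"
    using assms by (subst e) (auto simp: add_pos_nonneg)
  ultimately show ?thesis by (simp add: powr_mult)
qed

lemma profile_upper:
  assumes "R \<ge> 1" "p > 0"
  shows "profile p R x \<le> 2 powr p * (1 + norm x) powr (- 2 * p)"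
proof -
  have e: "w powr (- 2 * p) = (w\<^sup>2) powr (-p)" if "w > 0" for w :: real
    using that by (simp add: powr_powr flip: powr_numeral)
  have "(1 + norm x)\<^sup>2 / 2 \<le> R\<^sup>2 + (norm x)\<^sup>2"
  proof -
    have "1 \<le> R\<^sup>2" using assms by simp
    then show ?thesis using sum_squares_bound[of 1 "norm x"] by (simp add: power2_sum)
  qed
  moreover have "0 < (1 + norm x)\<^sup>2 / 2"
    by (intro divide_pos_pos zero_less_power) (use norm_ge_zero[of x] in linarith)+
  ultimately have "profile p R x \<le> ((1 + norm x)\<^sup>2 / 2) powr (-p)"
    unfolding profile_def by (intro powr_mono2') (use assms in auto)
  also have "\<dots> = 2 powr p * ((1 + norm x)\<^sup>2) powr (-p)"
    by (rule powr_neg_quotient)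
  also have "((1 + norm x)\<^sup>2) powr (-p) = (1 + norm x) powr (- 2 * p)"
    by (rule e[symmetric]) (simp add: add_pos_nonneg)
  finally show ?thesis .
qed

text \<open>Replacing \<open>|y|\<close> by \<open>sqrt (1 + |y|\<^sup>2)\<close> removes the kink at the origin and changes the function only by
  a factor between \<open>exp (- \<theta>)\<close> and 1.\<close>

definition exp_profile :: "real \<Rightarrow> real^'m \<Rightarrow> real" where
  "exp_profile \<theta> y = exp (- \<theta> * sqrt (1 + (norm y)\<^sup>2))"

text \<open>The Laplacian of \<open>exp_profile \<theta>\<close>, in closed form; \<open>exp_profile_line_derivatives\<close> yields its summands.\<close>

definition exp_profile_laplacian :: "real \<Rightarrow> real^'m \<Rightarrow> real" where
  "exp_profile_laplacian \<theta> y =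
     (let s = sqrt (1 + (norm y)\<^sup>2) in
       (\<theta>\<^sup>2 * ((norm y)\<^sup>2 / s\<^sup>2) - \<theta> * (real CARD('m) / s - (norm y)\<^sup>2 / s ^ 3)) * exp_profile \<theta> y)"

lemma exp_profile_pos: "0 < exp_profile \<theta> y"
  by (simp add: exp_profile_def)

lemma continuous_exp_profile [continuous_intros]:
  "continuous_on S g \<Longrightarrow> continuous_on S (\<lambda>t. exp_profile \<theta> (g t))"
  unfolding exp_profile_def by (intro continuous_intros)

lemma exp_profile_bounds:
  assumes "\<theta> \<ge> 0"
  shows "exp (- \<theta>) * exp (- \<theta> * norm y) \<le> exp_profile \<theta> y" "exp_profile \<theta> y \<le> exp (- \<theta> * norm y)"
proof -
  have "sqrt (1 + (norm y)\<^sup>2) \<le> 1 + norm y"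
    by (rule real_le_lsqrt) (auto simp: power2_sum)
  from mult_left_mono[OF this assms] show "exp (- \<theta>) * exp (- \<theta> * norm y) \<le> exp_profile \<theta> y"
    unfolding exp_profile_def exp_add[symmetric] by (simp add: algebra_simps)
  have "norm y \<le> sqrt (1 + (norm y)\<^sup>2)" by (rule real_le_rsqrt) simp
  from mult_left_mono[OF this assms] show "exp_profile \<theta> y \<le> exp (- \<theta> * norm y)"
    unfolding exp_profile_def by simp
qed

lemma exp_profile_laplacian_le:
  fixes y :: "real^'m"
  assumes "\<theta> \<ge> 0"
  shows "exp_profile_laplacian \<theta> y \<le> \<theta>\<^sup>2 * exp_profile \<theta> y"
proof -
  define s where "s = sqrt (1 + (norm y)\<^sup>2)"
  have s: "s > 0" "s\<^sup>2 = 1 + (norm y)\<^sup>2" unfolding s_def by (simp_all add: add_pos_nonneg)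
  have q: "(norm y)\<^sup>2 / s\<^sup>2 \<le> 1" unfolding s(2) by (simp add: divide_le_eq add_pos_nonneg)
  have "(norm y)\<^sup>2 / s ^ 3 = ((norm y)\<^sup>2 / s\<^sup>2) / s" by (simp add: power3_eq_cube power2_eq_square)
  also have "\<dots> \<le> 1 / s" by (rule divide_right_mono) (use q s in auto)
  also have "\<dots> \<le> real CARD('m) / s"
    by (rule divide_right_mono) (use s in \<open>auto simp: Suc_le_eq\<close>)
  finally have "0 \<le> real CARD('m) / s - (norm y)\<^sup>2 / s ^ 3" by simp
  then have "0 \<le> \<theta> * (real CARD('m) / s - (norm y)\<^sup>2 / s ^ 3)" using assms by (rule mult_nonneg_nonneg[rotated])
  moreover have "\<theta>\<^sup>2 * ((norm y)\<^sup>2 / s\<^sup>2) \<le> \<theta>\<^sup>2" using mult_left_mono[OF q, of "\<theta>\<^sup>2"] by simp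
  ultimately have "\<theta>\<^sup>2 * ((norm y)\<^sup>2 / s\<^sup>2) - \<theta> * (real CARD('m) / s - (norm y)\<^sup>2 / s ^ 3) \<le> \<theta>\<^sup>2" by linarith
  then show ?thesis
    unfolding exp_profile_laplacian_def Let_def s_def[symmetric]
    using exp_profile_pos[of \<theta> y] by (intro mult_right_mono) auto
qed

text \<open>The first bound holds everywhere but is weak; the second one shows that the exponential is
  nearly an eigenfunction for \<open>\<theta>\<^sup>2\<close> when \<open>|y|\<close> is large.\<close>

lemma exp_profile_laplacian_ge:
  fixes y :: "real^'m"
  assumes "\<theta> \<ge> 0"
  shows "- (\<theta> * real CARD('m)) * exp_profile \<theta> y \<le> exp_profile_laplacian \<theta> y"
    and "L > 0 \<Longrightarrow> L \<le> norm y \<Longrightarrow>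
      (\<theta>\<^sup>2 - (\<theta>\<^sup>2 + \<theta> * real CARD('m)) / L) * exp_profile \<theta> y \<le> exp_profile_laplacian \<theta> y"
proof -
  define s where "s = sqrt (1 + (norm y)\<^sup>2)"
  have s: "s \<ge> 1" "s\<^sup>2 = 1 + (norm y)\<^sup>2" unfolding s_def by (simp_all add: add_pos_nonneg)
  have ge: "\<theta>\<^sup>2 * ((norm y)\<^sup>2 / s\<^sup>2) - \<theta> * (real CARD('m) / s)
     \<le> \<theta>\<^sup>2 * ((norm y)\<^sup>2 / s\<^sup>2) - \<theta> * (real CARD('m) / s - (norm y)\<^sup>2 / s ^ 3)"
    using assms s by (intro diff_left_mono mult_left_mono) auto
  have "real CARD('m) / s \<le> real CARD('m)" using s by (simp add: divide_le_eq mult_left_mono[of 1, simplified])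
  then have "\<theta> * (real CARD('m) / s) \<le> \<theta> * real CARD('m)" using assms by (rule mult_left_mono)
  moreover have "0 \<le> \<theta>\<^sup>2 * ((norm y)\<^sup>2 / s\<^sup>2)" by simp
  ultimately have "- (\<theta> * real CARD('m)) \<le> \<theta>\<^sup>2 * ((norm y)\<^sup>2 / s\<^sup>2) - \<theta> * (real CARD('m) / s - (norm y)\<^sup>2 / s ^ 3)"
    using ge by linarith
  then show "- (\<theta> * real CARD('m)) * exp_profile \<theta> y \<le> exp_profile_laplacian \<theta> y"
    unfolding exp_profile_laplacian_def Let_def s_def[symmetric]
    using exp_profile_pos[of \<theta> y] by (intro mult_right_mono) auto
  assume L: "L > 0" "L \<le> norm y"
  have "norm y \<le> s" unfolding s_def by (rule real_le_rsqrt) simp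
  then have Ls: "L \<le> s" using L by linarith
  have "(norm y)\<^sup>2 / s\<^sup>2 = 1 - 1 / s\<^sup>2"
  proof -
    have "s\<^sup>2 \<noteq> 0" "(norm y)\<^sup>2 = s\<^sup>2 - 1" using s by auto
    then show ?thesis by (simp add: diff_divide_distrib)
  qed
  moreover have "1 / s\<^sup>2 \<le> 1 / L"
  proof (rule divide_left_mono)
    show "L \<le> s\<^sup>2" using Ls self_le_power[of s 2] s(1) by simp
  qed (use L s(1) in auto)
  ultimately have "\<theta>\<^sup>2 * (1 - 1 / L) \<le> \<theta>\<^sup>2 * ((norm y)\<^sup>2 / s\<^sup>2)" by (intro mult_left_mono) auto
  moreover have "\<theta> * (real CARD('m) / s) \<le> \<theta> * (real CARD('m) / L)"
    using assms Ls L by (intro mult_left_mono divide_left_mono) auto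
  ultimately have "\<theta>\<^sup>2 - (\<theta>\<^sup>2 + \<theta> * real CARD('m)) / L
     \<le> \<theta>\<^sup>2 * ((norm y)\<^sup>2 / s\<^sup>2) - \<theta> * (real CARD('m) / s - (norm y)\<^sup>2 / s ^ 3)"
    using ge by (simp add: algebra_simps add_divide_distrib)
  then show "(\<theta>\<^sup>2 - (\<theta>\<^sup>2 + \<theta> * real CARD('m)) / L) * exp_profile \<theta> y \<le> exp_profile_laplacian \<theta> y"
    unfolding exp_profile_laplacian_def Let_def s_def[symmetric]
    using exp_profile_pos[of \<theta> y] by (intro mult_right_mono) auto
qed

section \<open>The two operators at a maximum of the difference from a barrier\<close>

text \<open>The second derivative is only assumed to exist at the maximum. If it were positive, the first
  derivative would be positive just to the right, and the function would increase there.\<close>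

lemma second_derivative_nonpos_at_max:
  fixes g g' :: "real \<Rightarrow> real"
  assumes g: "\<And>t. (g has_real_derivative g' t) (at t)"
    and g': "(g' has_real_derivative D) (at a)"
    and max: "\<And>t. g t \<le> g a"
  shows "D \<le> 0"
proof (rule ccontr)
  assume "\<not> D \<le> 0"
  then obtain d where d: "d > 0" "\<And>h. 0 < h \<Longrightarrow> h < d \<Longrightarrow> g' a < g' (a + h)"
    using DERIV_pos_inc_right[OF g'] by auto
  have g'a: "g' a = 0" using DERIV_local_max[OF g, of 1 a] max by auto
  obtain z where z: "a < z" "z < a + d / 2" "g (a + d / 2) - g a = (a + d / 2 - a) * g' z"
    using MVT2[of a "a + d / 2" g g'] g d(1) by auto
  have "g' z > 0" using d(2)[of "z - a"] z g'a d(1) by auto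
  then have "g (a + d / 2) - g a > 0" unfolding z(3) using d(1) by simp
  then show False using max[of "a + d / 2"] by simp
qed

lemma has_partial_y_imp_derivative:
  assumes "has_partial_y i u"
  shows "((\<lambda>t. u (x, y + t *\<^sub>R axis i 1)) has_real_derivative
    partial_y i u (x, y + t *\<^sub>R axis i 1)) (at t)"
proof -
  have "((\<lambda>h. u (x, (y + t *\<^sub>R axis i 1) + h *\<^sub>R axis i 1)) has_real_derivative
      partial_y i u (x, y + t *\<^sub>R axis i 1)) (at 0)"
    using assms unfolding has_partial_y_def partial_y_def
    by (simp add: DERIV_deriv_iff_field_differentiable)
  then have "((\<lambda>h. u (x, y + (h + t) *\<^sub>R axis i 1)) has_real_derivative
      partial_y i u (x, y + t *\<^sub>R axis i 1)) (at 0)"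
    by (simp add: algebra_simps)
  then show ?thesis using DERIV_shift[of "\<lambda>h. u (x, y + h *\<^sub>R axis i 1)" _ 0 t] by simp
qed

lemma norm_add_axis_power2:
  fixes y :: "real^'m"
  shows "(norm (y + t *\<^sub>R axis i 1))\<^sup>2 = (norm y)\<^sup>2 + 2 * t * (y $ i) + t\<^sup>2"
proof -
  have "y \<bullet> (t *\<^sub>R axis i 1) = t * (y $ i)" by (simp add: inner_axis)
  moreover have "(norm (t *\<^sub>R axis i (1::real) :: real^'m))\<^sup>2 = t\<^sup>2" by (simp add: power_mult_distrib)
  moreover have "2 * (y \<bullet> (t *\<^sub>R axis i 1))
      = (norm (y + t *\<^sub>R axis i 1))\<^sup>2 - (norm y)\<^sup>2 - (norm (t *\<^sub>R axis i (1::real) :: real^'m))\<^sup>2"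
    by (subst dot_norm) (simp del: inner_scaleR_right)
  ultimately show ?thesis by linarith
qed

lemma exp_profile_line_derivatives:
  fixes y :: "real^'m" and i :: 'm and \<theta> :: real
  defines "q \<equiv> (\<lambda>t. sqrt (1 + (norm y)\<^sup>2 + 2 * t * (y $ i) + t\<^sup>2))"
  shows "((\<lambda>t. exp_profile \<theta> (y + t *\<^sub>R axis i 1)) has_real_derivative
      - \<theta> * ((y $ i + t) / q t) * exp (- \<theta> * q t)) (at t)"
    and "((\<lambda>t. - \<theta> * ((y $ i + t) / q t) * exp (- \<theta> * q t)) has_real_derivative
      (\<theta>\<^sup>2 * ((y $ i)\<^sup>2 / (q 0)\<^sup>2) - \<theta> * (1 / q 0 - (y $ i)\<^sup>2 / (q 0) ^ 3)) * exp (- \<theta> * q 0)) (at 0)"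
proof -
  have eq: "1 + (norm y)\<^sup>2 + 2 * t * (y $ i) + t\<^sup>2 = 1 + (norm (y + t *\<^sub>R axis i 1))\<^sup>2" for t
    by (simp add: norm_add_axis_power2)
  have pos: "1 + (norm y)\<^sup>2 + 2 * t * (y $ i) + t\<^sup>2 > 0" for t
    unfolding eq by (simp add: add_pos_nonneg)
  then have qpos: "q t > 0" for t by (simp add: q_def)
  have q': "(q has_real_derivative (y $ i + t) / q t) (at t)" for t
  proof -
    have "(q has_real_derivative inverse (q t) / 2 * (2 * (y $ i) + 2 * t)) (at t)"
      unfolding q_def
    proof (rule DERIV_chain2[where f = sqrt])
      show "((\<lambda>t. 1 + (norm y)\<^sup>2 + 2 * t * (y $ i) + t\<^sup>2) has_real_derivative 2 * (y $ i) + 2 * t) (at t)"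
        by (auto intro!: derivative_eq_intros)
    qed (rule DERIV_real_sqrt[OF pos])
    moreover have "inverse (q t) / 2 * (2 * (y $ i) + 2 * t) = (y $ i + t) / q t"
      unfolding divide_inverse[of _ "q t"] by algebra
    ultimately show ?thesis by (simp only:)
  qed
  have E: "((\<lambda>t. exp (- \<theta> * q t)) has_real_derivative - \<theta> * ((y $ i + t) / q t) * exp (- \<theta> * q t)) (at t)" for t
    by (auto intro!: derivative_eq_intros q')
  have "exp_profile \<theta> (y + t *\<^sub>R axis i 1) = exp (- \<theta> * q t)" for t
    unfolding exp_profile_def q_def eq ..
  then show "((\<lambda>t. exp_profile \<theta> (y + t *\<^sub>R axis i 1)) has_real_derivative
      - \<theta> * ((y $ i + t) / q t) * exp (- \<theta> * q t)) (at t)"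
    using E by simp
  have Q: "((\<lambda>t. (y $ i + t) / q t) has_real_derivative 1 / q 0 - (y $ i)\<^sup>2 / (q 0) ^ 3) (at 0)"
    using qpos[of 0] by (auto intro!: derivative_eq_intros q' simp: field_simps power2_eq_square power3_eq_cube)
  show "((\<lambda>t. - \<theta> * ((y $ i + t) / q t) * exp (- \<theta> * q t)) has_real_derivative
      (\<theta>\<^sup>2 * ((y $ i)\<^sup>2 / (q 0)\<^sup>2) - \<theta> * (1 / q 0 - (y $ i)\<^sup>2 / (q 0) ^ 3)) * exp (- \<theta> * q 0)) (at 0)"
    by (rule DERIV_cong[OF DERIV_mult[OF DERIV_cmult[OF Q, of "-\<theta>"] E]])
      (simp add: power2_eq_square algebra_simps)
qed

text \<open>The sign \<open>\<sigma>\<close> allows touching from above (\<open>\<sigma> = 1\<close>) and from below (\<open>\<sigma> = - 1\<close>).\<close>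

lemma laplacian_y_at_max:
  fixes u :: "(real^'n) \<times> (real^'m) \<Rightarrow> real"
  assumes u: "\<And>i. has_partial_y i u" "\<And>i. has_partial_y i (partial_y i u)"
    and max: "\<And>y. \<sigma> * (u (x0, y) - c * exp_profile \<theta> y) \<le> \<sigma> * (u (x0, y0) - c * exp_profile \<theta> y0)"
  shows "0 \<le> \<sigma> * (minus_laplacian_y u x0 y0 + c * exp_profile_laplacian \<theta> y0)"
proof -
  define s where "s = sqrt (1 + (norm y0)\<^sup>2)"
  define D where "D = (\<lambda>i. (\<theta>\<^sup>2 * ((y0 $ i)\<^sup>2 / s\<^sup>2) - \<theta> * (1 / s - (y0 $ i)\<^sup>2 / s ^ 3)) * exp (- \<theta> * s))"
  have "\<sigma> * (partial_y i (partial_y i u) (x0, y0) - c * D i) \<le> 0" for i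
  proof -
    define q where "q = (\<lambda>t. sqrt (1 + (norm y0)\<^sup>2 + 2 * t * (y0 $ i) + t\<^sup>2))"
    have q0: "q 0 = s" by (simp add: q_def s_def)
    have d2: "((\<lambda>t. - \<theta> * ((y0 $ i + t) / q t) * exp (- \<theta> * q t)) has_real_derivative D i) (at 0)"
      using exp_profile_line_derivatives(2)[of \<theta> y0 i] unfolding q_def D_def s_def by simp
    show ?thesis
    proof (rule second_derivative_nonpos_at_max)
      show "((\<lambda>t. \<sigma> * (u (x0, y0 + t *\<^sub>R axis i 1) - c * exp_profile \<theta> (y0 + t *\<^sub>R axis i 1)))
        has_real_derivative \<sigma> * (partial_y i u (x0, y0 + t *\<^sub>R axis i 1)
          - c * (- \<theta> * ((y0 $ i + t) / q t) * exp (- \<theta> * q t)))) (at t)" for t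
        unfolding q_def
        by (intro DERIV_cmult DERIV_diff has_partial_y_imp_derivative u exp_profile_line_derivatives(1))
      show "((\<lambda>t. \<sigma> * (partial_y i u (x0, y0 + t *\<^sub>R axis i 1)
          - c * (- \<theta> * ((y0 $ i + t) / q t) * exp (- \<theta> * q t)))) has_real_derivative
          \<sigma> * (partial_y i (partial_y i u) (x0, y0) - c * D i)) (at 0)"
        using has_partial_y_imp_derivative[OF u(2), where x = x0 and y = y0 and i = i and t = 0]
        by (intro DERIV_cmult DERIV_diff d2) simp
    qed (use max in simp)
  qed
  then have "(\<Sum>i\<in>UNIV. \<sigma> * (partial_y i (partial_y i u) (x0, y0) - c * D i)) \<le> 0"
    by (rule sum_nonpos)
  moreover have "(\<Sum>i\<in>UNIV. D i) = exp_profile_laplacian \<theta> y0"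
  proof -
    have n: "(norm y0)\<^sup>2 = (\<Sum>i\<in>UNIV. (y0 $ i)\<^sup>2)"
      by (simp add: norm_vec_def L2_set_def sum_nonneg)
    have "(\<Sum>i\<in>UNIV. \<theta>\<^sup>2 * ((y0 $ i)\<^sup>2 / s\<^sup>2) - \<theta> * (1 / s - (y0 $ i)\<^sup>2 / s ^ 3))
        = \<theta>\<^sup>2 * ((norm y0)\<^sup>2 / s\<^sup>2) - \<theta> * (real CARD('m) / s - (norm y0)\<^sup>2 / s ^ 3)"
      unfolding n
      by (simp add: sum_subtractf sum_distrib_left[symmetric] sum_divide_distrib[symmetric])
    moreover have "exp_profile \<theta> y0 = exp (- \<theta> * s)" by (simp only: exp_profile_def s_def)
    ultimately show ?thesis
      unfolding exp_profile_laplacian_def Let_def s_def[symmetric] D_def sum_distrib_right[symmetric]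
      by (simp only:)
  qed
  moreover have "(\<Sum>i\<in>UNIV. \<sigma> * (partial_y i (partial_y i u) (x0, y0) - c * D i))
      = - (\<sigma> * (- (\<Sum>i\<in>UNIV. partial_y i (partial_y i u) (x0, y0)) + c * (\<Sum>i\<in>UNIV. D i)))"
    unfolding sum_distrib_left[symmetric] sum_subtractf by algebra
  ultimately show ?thesis
    unfolding minus_laplacian_y_def by (simp only: neg_le_0_iff_le)
qed


text \<open>At a maximum of \<open>\<sigma> * (u - \<phi>)\<close>, the increments satisfy
  \<open>\<sigma> * (u (x0) - u (z)) \<ge> \<sigma> * (\<phi> (x0) - \<phi> (z))\<close>, and integrating against the kernel compares the
  truncated operators before any limit is taken. If the inequality has a margin \<open>g\<close> on a set \<open>S\<close>
  at distance between 1 and \<open>D\<close> from \<open>x0\<close>, the margin contributes \<open>g\<close> times the measure of \<open>S\<close> times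
  the smallest value of the kernel on \<open>S\<close>. This gain is what the lower bound rests on; \<open>S = {}\<close> gives the
  plain comparison.\<close>

lemma frac_laplacian_x_at_max:
  fixes u :: "(real^'n) \<times> (real^'m) \<Rightarrow> real" and \<phi> :: "real^'n \<Rightarrow> real"
  assumes \<alpha>: "0 < \<alpha>"
    and ex: "frac_laplacian_x_exists \<alpha> u x0 y0"
    and \<phi>: "\<phi> \<in> borel_measurable borel" "\<And>z. \<bar>\<phi> z\<bar> \<le> K"
    and lower: "\<And>r. 0 < r \<Longrightarrow> r < \<rho> \<Longrightarrow>
      E \<le> \<sigma> * (LINT z:{z. r < norm (x0 - z)}|lborel. (\<phi> x0 - \<phi> z) / norm (x0 - z) powr (real CARD('n) + 2 * \<alpha>))"
    and "0 < \<rho>" "0 \<le> g"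
    and S: "S \<in> sets borel" "\<And>z. z \<in> S \<Longrightarrow> 1 \<le> norm (x0 - z)" "\<And>z. z \<in> S \<Longrightarrow> norm (x0 - z) \<le> D"
    and max: "\<And>z. \<sigma> * (u (z, y0) - \<phi> z) + g * indicator S z \<le> \<sigma> * (u (x0, y0) - \<phi> x0)"
  shows "E + g * measure lborel S / D powr (real CARD('n) + 2 * \<alpha>) \<le> \<sigma> * frac_laplacian_x \<alpha> u x0 y0"
proof -
  define s where "s = real CARD('n) + 2 * \<alpha>"
  have s: "real DIM(real^'n) < s" using \<alpha> by (simp add: s_def)
  obtain l where l: "(frac_trunc_x \<alpha> u x0 y0 \<longlongrightarrow> l) (at_right 0)"
    and iu: "\<And>r. r > 0 \<Longrightarrow> set_integrable lborel {z. r < norm (x0 - z)}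
        (\<lambda>z. (u (x0, y0) - u (z, y0)) / norm (x0 - z) powr s)"
    using ex unfolding frac_laplacian_x_exists_def s_def by auto
  have l_eq: "frac_laplacian_x \<alpha> u x0 y0 = l"
    unfolding frac_laplacian_x_def by (rule tendsto_Lim[OF _ l]) simp
  have "E + g * measure lborel S / D powr s \<le> \<sigma> * frac_trunc_x \<alpha> u x0 y0 r"
    if r: "0 < r" "r < min \<rho> 1" for r
  proof -
    define T where "T = {z. r < norm (x0 - z)}"
    have [measurable]: "T \<in> sets borel" "S \<in> sets borel" "\<phi> \<in> borel_measurable borel"
      using S \<phi> by (auto simp: T_def)
    have i\<phi>: "set_integrable lborel T (\<lambda>z. (\<phi> x0 - \<phi> z) / norm (x0 - z) powr s)"
      unfolding T_def
    proof (rule set_integrable_divide_norm_powr_outside)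
      show "\<bar>\<phi> x0 - \<phi> z\<bar> \<le> K + K" for z using \<phi>(2)[of x0] \<phi>(2)[of z] by linarith
    qed (use s r in auto)
    have iS: "set_integrable lborel T (\<lambda>z. indicator S z / norm (x0 - z) powr s)"
      unfolding T_def
    proof (rule set_integrable_divide_norm_powr_outside)
      show "\<bar>indicator S z\<bar> \<le> (1::real)" for z :: "real^'n" by (simp add: indicator_def)
    qed (use s r in auto)
    have ST: "S \<subseteq> T" using S(2) r by (force simp: T_def)
    have "S \<subseteq> cball x0 D" using S(3) by (auto simp: dist_norm)
    then have fin: "emeasure lborel S < \<infinity>"
      by (intro le_less_trans[OF emeasure_mono emeasure_lborel_cball_finite]) auto
    have iST: "set_integrable lborel T (\<lambda>z. indicator S z * (1 / D powr s))"
      unfolding set_integrable_def using fin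
      by (intro integrable_mult_indicator integrable_mult_left integrable_real_indicator) auto
    have "measure lborel S / D powr s = (LINT z:T|lborel. indicator S z * (1 / D powr s))"
    proof -
      have "measure lborel S / D powr s = (\<integral>z. indicator S z * (1 / D powr s) \<partial>lborel)"
        using fin by simp
      also have "\<dots> = (LINT z:T|lborel. indicator S z * (1 / D powr s))"
        unfolding set_lebesgue_integral_def
        by (rule Bochner_Integration.integral_cong) (use ST in \<open>auto simp: indicator_def\<close>)
      finally show ?thesis .
    qed
    also have "\<dots> \<le> (LINT z:T|lborel. indicator S z / norm (x0 - z) powr s)"
    proof (rule set_integral_mono[OF iST iS])
      fix z
      show "indicator S z * (1 / D powr s) \<le> indicator S z / norm (x0 - z) powr s"
      proof (cases "z \<in> S")
        case True
        then have "0 < norm (x0 - z) powr s" "norm (x0 - z) powr s \<le> D powr s"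
          using S(2,3)[of z] s by (auto intro!: powr_mono2 simp: order_less_le_trans[OF zero_less_one])
        then show ?thesis using True by (auto simp: frac_le)
      qed simp
    qed
    finally have mS: "measure lborel S / D powr s \<le> (LINT z:T|lborel. indicator S z / norm (x0 - z) powr s)" .
    have i1: "set_integrable lborel T (\<lambda>z. \<sigma> * ((\<phi> x0 - \<phi> z) / norm (x0 - z) powr s))"
      by (intro set_integrable_mult_right i\<phi>)
    have i2: "set_integrable lborel T (\<lambda>z. g * (indicator S z / norm (x0 - z) powr s))"
      by (intro set_integrable_mult_right iS)
    have i3: "set_integrable lborel T (\<lambda>z. \<sigma> * ((u (x0, y0) - u (z, y0)) / norm (x0 - z) powr s))"
      using iu[OF r(1)] unfolding T_def by (intro set_integrable_mult_right)
    have "E + g * (measure lborel S / D powr s)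
      \<le> \<sigma> * (LINT z:T|lborel. (\<phi> x0 - \<phi> z) / norm (x0 - z) powr s)
        + g * (LINT z:T|lborel. indicator S z / norm (x0 - z) powr s)"
      using lower[of r] r mS \<open>0 \<le> g\<close> unfolding T_def s_def by (intro add_mono mult_left_mono) auto
    also have "\<dots> = (LINT z:T|lborel. \<sigma> * ((\<phi> x0 - \<phi> z) / norm (x0 - z) powr s)
        + g * (indicator S z / norm (x0 - z) powr s))"
      by (simp only: set_integral_add(2)[OF i1 i2] set_integral_mult_right)
    also have "\<dots> \<le> (LINT z:T|lborel. \<sigma> * ((u (x0, y0) - u (z, y0)) / norm (x0 - z) powr s))"
    proof (rule set_integral_mono[OF set_integral_add(1)[OF i1 i2] i3])
      fix z
      have "\<sigma> * (\<phi> x0 - \<phi> z) + g * indicator S z \<le> \<sigma> * (u (x0, y0) - u (z, y0))"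
        using max[of z] by (simp add: right_diff_distrib)
      then have "(\<sigma> * (\<phi> x0 - \<phi> z) + g * indicator S z) / norm (x0 - z) powr s
         \<le> (\<sigma> * (u (x0, y0) - u (z, y0))) / norm (x0 - z) powr s"
        by (rule divide_right_mono) simp
      then show "\<sigma> * ((\<phi> x0 - \<phi> z) / norm (x0 - z) powr s) + g * (indicator S z / norm (x0 - z) powr s)
        \<le> \<sigma> * ((u (x0, y0) - u (z, y0)) / norm (x0 - z) powr s)"
        by (simp add: add_divide_distrib)
    qed
    also have "\<dots> = \<sigma> * frac_trunc_x \<alpha> u x0 y0 r"
      by (simp only: frac_trunc_x_def T_def s_def set_integral_mult_right)
    finally show ?thesis by simp
  qed
  then have "\<forall>\<^sub>F r in at_right 0. E + g * measure lborel S / D powr s \<le> \<sigma> * frac_trunc_x \<alpha> u x0 y0 r"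
    unfolding eventually_at_right_field using \<open>0 < \<rho>\<close> by (intro exI[of _ "min \<rho> 1"]) auto
  then show ?thesis
    unfolding l_eq s_def[symmetric]
    by (intro tendsto_lowerbound[OF tendsto_mult_left[OF l]]) auto
qed

lemma attains_positive_max:
  fixes v :: "'a::euclidean_space \<Rightarrow> real"
  assumes cont: "continuous_on UNIV v" and lim: "(v \<longlongrightarrow> 0) at_infinity" and q: "0 < v q"
  obtains p where "0 < v p" "\<And>z. v z \<le> v p"
proof -
  obtain b where b: "\<And>z. b \<le> norm z \<Longrightarrow> dist (v z) 0 < v q"
    using lim q unfolding Lim_at_infinity by blast
  define c where "c = max b (norm q)"
  have "\<exists>p\<in>cball 0 c. \<forall>z\<in>cball 0 c. v z \<le> v p"
    by (rule continuous_attains_sup)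
      (use continuous_on_subset[OF cont] in \<open>auto simp: c_def intro!: exI[of _ q] simp: not_less\<close>)
  then obtain p where p_max: "\<forall>z\<in>cball 0 c. v z \<le> v p" by blast
  have p: "v z \<le> v p" if "norm z \<le> c" for z using p_max that by simp
  have qp: "v q \<le> v p" by (rule p) (simp add: c_def)
  show ?thesis
  proof (rule that[of p])
    show "0 < v p" using q qp by simp
    fix z show "v z \<le> v p"
    proof (cases "norm z \<le> c")
      case False
      then have "b \<le> norm z" by (simp add: c_def)
      then have "v z < v q" using b[of z] by (simp add: dist_real_def)
      then show ?thesis using qp by simp
    qed (use p in simp)
  qed
qed

text \<open>Boundedness matters: at infinity of the product space only one of the two variables has to be
  large.\<close>

lemma tendsto_product_at_infinity:
  fixes f :: "'a::euclidean_space \<Rightarrow> real" and g :: "'b::euclidean_space \<Rightarrow> real"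
  assumes f: "(f \<longlongrightarrow> 0) at_infinity" "\<And>x. \<bar>f x\<bar> \<le> K"
    and g: "(g \<longlongrightarrow> 0) at_infinity" "\<And>y. \<bar>g y\<bar> \<le> K"
  shows "((\<lambda>(x, y). f x * g y) \<longlongrightarrow> 0) at_infinity"
  unfolding Lim_at_infinity
proof (intro allI impI)
  fix e :: real assume e: "0 < e"
  define k where "k = \<bar>K\<bar> + 1"
  have k: "k > 0" "\<bar>f x\<bar> \<le> k" "\<bar>g y\<bar> \<le> k" for x y
    using f(2)[of x] g(2)[of y] unfolding k_def by linarith+
  obtain b where b: "\<And>x. b \<le> norm x \<Longrightarrow> \<bar>f x\<bar> < e / k"
    using f(1) e k(1) unfolding Lim_at_infinity dist_real_def by (metis diff_zero divide_pos_pos)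
  obtain c where c: "\<And>y. c \<le> norm y \<Longrightarrow> \<bar>g y\<bar> < e / k"
    using g(1) e k(1) unfolding Lim_at_infinity dist_real_def by (metis diff_zero divide_pos_pos)
  show "\<exists>d. \<forall>p. d \<le> norm p \<longrightarrow> dist (case p of (x, y) \<Rightarrow> f x * g y) 0 < e"
  proof (intro exI[of _ "\<bar>b\<bar> + \<bar>c\<bar>"] allI impI)
    fix p :: "'a \<times> 'b" assume p: "\<bar>b\<bar> + \<bar>c\<bar> \<le> norm p"
    obtain x y where xy: "p = (x, y)" by fastforce
    have "norm p \<le> norm x + norm y" unfolding xy by (rule norm_Pair_le)
    then consider "b \<le> norm x" | "c \<le> norm y" using p by linarith
    then have "\<bar>f x\<bar> * \<bar>g y\<bar> < e"
    proof cases
      case 1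
      have "\<bar>f x\<bar> * \<bar>g y\<bar> \<le> \<bar>f x\<bar> * k" by (intro mult_left_mono k) simp
      also have "\<dots> < e" using b[OF 1] k(1) by (simp add: pos_less_divide_eq)
      finally show ?thesis .
    next
      case 2
      have "\<bar>f x\<bar> * \<bar>g y\<bar> \<le> k * \<bar>g y\<bar>" by (intro mult_right_mono k) simp
      also have "\<dots> < e" using c[OF 2] k(1) by (simp add: pos_less_divide_eq mult.commute)
      finally show ?thesis .
    qed
    then show "dist (case p of (x, y) \<Rightarrow> f x * g y) 0 < e" by (simp add: xy abs_mult)
  qed
qed

lemma profile_tendsto_0:
  assumes "p > 0"
  shows "(profile p R \<longlongrightarrow> 0) (at_infinity :: 'a::real_normed_vector filter)"
proof -
  have "filterlim (\<lambda>x::'a. (norm x)\<^sup>2) at_top at_infinity"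
    by (rule filterlim_pow_at_top) (auto intro: filterlim_norm_at_top)
  then have "filterlim (\<lambda>x::'a. R\<^sup>2 + (norm x)\<^sup>2) at_top at_infinity"
    by (rule filterlim_tendsto_add_at_top[OF tendsto_const])
  then show ?thesis unfolding profile_def[abs_def] by (rule tendsto_neg_powr[rotated]) (use assms in simp)
qed

lemma exp_profile_tendsto_0:
  assumes "\<theta> > 0"
  shows "(exp_profile \<theta> \<longlongrightarrow> 0) at_infinity"
proof (rule tendsto_sandwich[OF _ _ tendsto_const])
  have "filterlim (\<lambda>y::real^'m. \<theta> * norm y) at_top at_infinity"
    by (rule filterlim_tendsto_pos_mult_at_top[OF tendsto_const assms filterlim_norm_at_top])
  then have "filterlim (\<lambda>y::real^'m. - (\<theta> * norm y)) at_bot at_infinity"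
    by (simp add: filterlim_uminus_at_bot)
  from filterlim_compose[OF exp_at_bot this]
  show "((\<lambda>y::real^'m. exp (- \<theta> * norm y)) \<longlongrightarrow> 0) at_infinity" by simp
  show "\<forall>\<^sub>F y::real^'m in at_infinity. 0 \<le> exp_profile \<theta> y"
    using exp_profile_pos by (auto intro!: always_eventually less_imp_le)
  show "\<forall>\<^sub>F y::real^'m in at_infinity. exp_profile \<theta> y \<le> exp (- \<theta> * norm y)"
    using exp_profile_bounds(2)[of \<theta>] assms by (auto intro!: always_eventually)
qed


section \<open>Product barriers and comparison\<close>

lemma powr_neg_scale_small:
  fixes C \<eta> a :: real
  assumes "0 < \<eta>" "0 < a"
  obtains R where "1 \<le> R" "C * R powr (- a) \<le> \<eta>"
proof -
  have "((\<lambda>R. C * R powr (- a)) \<longlongrightarrow> C * 0) at_top"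
    by (intro tendsto_mult tendsto_const tendsto_neg_powr filterlim_ident) (use assms in simp)
  then have "\<forall>\<^sub>F R in at_top. C * R powr (- a) < \<eta>"
    using assms(1) by (intro order_tendstoD(2)) auto
  with eventually_ge_at_top[of 1] have "\<forall>\<^sub>F R in at_top. 1 \<le> R \<and> C * R powr (- a) < \<eta>"
    by eventually_elim simp
  then obtain R where "1 \<le> R" "C * R powr (- a) < \<eta>"
    unfolding eventually_at_top_linorder by blast
  then show ?thesis using that[of R] by simp
qed

text \<open>For every \<open>\<eta> > 0\<close> a single scale \<open>R\<close> makes all nonnegative multiples of the profile both sub- and
  supersolutions of the fractional equation up to \<open>\<eta>\<close>; the sign \<open>\<sigma>\<close> selects the side.\<close>

lemma profile_barrier:
  fixes \<alpha> \<eta> :: real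
  assumes \<alpha>: "0 < \<alpha>" "\<alpha> < 1" and \<eta>: "0 < \<eta>"
  obtains R where "1 \<le> R"
    "\<And>(x::real^'n) r \<sigma> c. 0 < r \<Longrightarrow> r < R / 2 \<Longrightarrow> \<bar>\<sigma>\<bar> \<le> 1 \<Longrightarrow> 0 \<le> c \<Longrightarrow>
      - (\<eta> * (c * profile ((real CARD('n) + 2 * \<alpha>) / 2) R x)) \<le>
      \<sigma> * (LINT z:{z. r < norm (x - z)}|lborel.
        (c * profile ((real CARD('n) + 2 * \<alpha>) / 2) R x - c * profile ((real CARD('n) + 2 * \<alpha>) / 2) R z)
          / norm (x - z) powr (real CARD('n) + 2 * \<alpha>))"
proof -
  define p where "p = (real CARD('n) + 2 * \<alpha>) / 2"
  have dim: "real DIM(real^'n) = real CARD('n)" by simp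
  obtain C where C: "C > 0"
    "\<And>(x::real^'n) R r. 0 < r \<Longrightarrow> r < R / 2 \<Longrightarrow>
      \<bar>LINT z:{z. r < norm (x - z)}|lborel. (profile p R x - profile p R z) / norm (x - z) powr (real CARD('n) + 2 * \<alpha>)\<bar>
        \<le> C * R powr (-2 * \<alpha>) * profile p R x"
    using profile_nonlocal_bound[OF \<alpha>, where 'a = "real^'n", unfolded dim, folded p_def] by blast
  obtain R where R: "1 \<le> R" "C * R powr (- (2 * \<alpha>)) \<le> \<eta>"
    using powr_neg_scale_small[OF \<eta>, of "2 * \<alpha>" C] \<alpha> by auto
  show ?thesis
  proof (rule that[OF R(1), folded p_def])
    fix x :: "real^'n" and r \<sigma> c :: real
    assume r: "0 < r" "r < R / 2" and \<sigma>: "\<bar>\<sigma>\<bar> \<le> 1" and c: "0 \<le> c"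
    define I where "I = (LINT z:{z. r < norm (x - z)}|lborel.
        (profile p R x - profile p R z) / norm (x - z) powr (real CARD('n) + 2 * \<alpha>))"
    have "(LINT z:{z. r < norm (x - z)}|lborel.
        (c * profile p R x - c * profile p R z) / norm (x - z) powr (real CARD('n) + 2 * \<alpha>)) = c * I"
      unfolding I_def set_integral_mult_right[symmetric] by (simp only: right_diff_distrib times_divide_eq_right)
    moreover have "\<bar>\<sigma> * (c * I)\<bar> \<le> \<eta> * (c * profile p R x)"
    proof -
      have "\<bar>I\<bar> \<le> C * R powr (-2 * \<alpha>) * profile p R x" unfolding I_def by (rule C(2)[OF r])
      also have "\<dots> \<le> \<eta> * profile p R x"
        using R profile_pos[of R p x] by (intro mult_right_mono) auto
      finally have "c * \<bar>I\<bar> \<le> c * (\<eta> * profile p R x)" using c by (rule mult_left_mono)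
      moreover have "\<bar>\<sigma>\<bar> * (c * \<bar>I\<bar>) \<le> 1 * (c * \<bar>I\<bar>)" using \<sigma> c by (intro mult_right_mono) auto
      ultimately show ?thesis using c by (simp add: abs_mult mult_ac)
    qed
    ultimately show "- (\<eta> * (c * profile p R x)) \<le> \<sigma> * (LINT z:{z. r < norm (x - z)}|lborel.
        (c * profile p R x - c * profile p R z) / norm (x - z) powr (real CARD('n) + 2 * \<alpha>))"
      by (simp add: abs_le_iff)
  qed
qed

lemma barrier_continuous:
  assumes "R > 0"
  shows "continuous_on S (\<lambda>q. k * (profile p R (fst q) * exp_profile \<theta> (snd q)))"
  by (intro continuous_intros assms)

lemma barrier_tendsto_0:
  assumes "R \<ge> 1" "p > 0" "\<theta> > 0"
  shows "((\<lambda>q. k * (profile p R (fst q :: real^'n) * exp_profile \<theta> (snd q :: real^'m))) \<longlongrightarrow> 0) at_infinity"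
proof -
  have "((\<lambda>(x::real^'n, y::real^'m). profile p R x * exp_profile \<theta> y) \<longlongrightarrow> 0) at_infinity"
  proof (rule tendsto_product_at_infinity)
    show "\<bar>profile p R x\<bar> \<le> max (R powr (-2*p)) 1" for x :: "real^'n"
      using profile_le[of R p x] profile_pos[of R p x] assms by (simp add: le_max_iff_disj)
    have "exp_profile \<theta> y \<le> 1" for y :: "real^'m"
      using exp_profile_bounds(2)[of \<theta> y] assms by (auto elim!: order_trans)
    then show "\<bar>exp_profile \<theta> y\<bar> \<le> max (R powr (-2*p)) 1" for y :: "real^'m"
      using exp_profile_pos[of \<theta> y] by (simp add: le_max_iff_disj)
  qed (use assms in \<open>auto intro!: profile_tendsto_0 exp_profile_tendsto_0\<close>)
  from tendsto_mult_left[OF this, of k] show ?thesis by (simp add: case_prod_beta)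
qed

text \<open>With \<open>R\<close> chosen such that the fractional part contributes at most \<open>\<kappa> - \<theta>\<^sup>2\<close>, the product is a
  supersolution for \<open>\<kappa>\<close> on the whole space. The multiple \<open>k\<close> is chosen on a ball outside of which
  \<open>u < v0\<close>, so at a positive maximum of \<open>u - k * W\<close> the hypothesis on \<open>f\<close> is available.\<close>

lemma decay_upper_bound:
  fixes u :: "(real^'n) \<times> (real^'m) \<Rightarrow> real"
  assumes \<alpha>: "0 < \<alpha>" "\<alpha> < 1"
    and sol: "classical_solution \<alpha> f u"
    and pos: "\<And>q. 0 < u q"
    and lim: "(u \<longlongrightarrow> 0) at_infinity"
    and \<theta>: "0 < \<theta>" "\<theta>\<^sup>2 < \<kappa>"
    and f: "0 < v0" "\<And>v. 0 < v \<Longrightarrow> v < v0 \<Longrightarrow> f v \<le> (1 - \<kappa>) * v"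
  obtains C where "C > 0"
    "\<And>x y. u (x, y) \<le> C * (1 + norm x) powr (- real CARD('n) - 2 * \<alpha>) * exp (- \<theta> * norm y)"
proof -
  define p where "p = (real CARD('n) + 2 * \<alpha>) / 2"
  have p: "p > 0" using \<alpha> by (simp add: p_def add_nonneg_pos)
  have cont: "continuous_on UNIV u" and ex: "\<And>x y. frac_laplacian_x_exists \<alpha> u x y"
    and partials: "\<And>i. has_partial_y i u" "\<And>i. has_partial_y i (partial_y i u)"
    and eq: "\<And>x y. frac_laplacian_x \<alpha> u x y + minus_laplacian_y u x y + u (x, y) = f (u (x, y))"
    using sol by (auto simp: classical_solution_def)
  obtain R where R: "1 \<le> R"
    "\<And>(x::real^'n) r \<sigma> c. 0 < r \<Longrightarrow> r < R / 2 \<Longrightarrow> \<bar>\<sigma>\<bar> \<le> 1 \<Longrightarrow> 0 \<le> c \<Longrightarrow>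
      - ((\<kappa> - \<theta>\<^sup>2) * (c * profile p R x)) \<le>
      \<sigma> * (LINT z:{z. r < norm (x - z)}|lborel.
        (c * profile p R x - c * profile p R z) / norm (x - z) powr (real CARD('n) + 2 * \<alpha>))"
    using profile_barrier[OF \<alpha>, of "\<kappa> - \<theta>\<^sup>2", where 'n = 'n, folded p_def] \<theta> by auto
  have Rp: "R > 0" using R by simp
  define W where "W = (\<lambda>q. profile p R (fst q :: real^'n) * exp_profile \<theta> (snd q :: real^'m))"
  have W_pos: "W q > 0" for q
    unfolding W_def using profile_pos[OF Rp] exp_profile_pos by (intro mult_pos_pos)
  obtain b where b: "\<And>q. b \<le> norm q \<Longrightarrow> u q < v0"
    using lim f(1) pos unfolding Lim_at_infinity dist_real_def by (metis abs_of_pos diff_zero)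
  have "continuous_on (cball 0 b) (\<lambda>q. u q / W q)"
  proof (intro continuous_on_divide continuous_on_subset[OF cont])
    show "continuous_on (cball 0 b) W"
      using barrier_continuous[OF Rp, of "cball 0 b" 1 p \<theta>] by (simp add: W_def)
    show "\<forall>q\<in>cball 0 b. W q \<noteq> 0" using W_pos by (metis less_irrefl)
  qed simp
  then have "compact ((\<lambda>q. u q / W q) ` cball 0 b)" by (intro compact_continuous_image) auto
  then obtain k where k0: "k > 0" and k_bound: "\<forall>t\<in>(\<lambda>q. u q / W q) ` cball 0 b. norm t \<le> k"
    using compact_imp_bounded bounded_pos by metis
  have k: "\<bar>u q / W q\<bar> \<le> k" if "q \<in> cball 0 b" for q
    using k_bound that unfolding real_norm_def by blast
  define v where "v = (\<lambda>q. u q - k * W q)"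
  have v_in: "v q \<le> 0" if "norm q \<le> b" for q
    using k[of q] that W_pos[of q] by (simp add: v_def abs_le_iff divide_le_eq)
  have v_cont: "continuous_on UNIV v"
    unfolding v_def W_def by (intro continuous_on_diff cont barrier_continuous Rp)
  have v_lim: "(v \<longlongrightarrow> 0) at_infinity"
    using tendsto_diff[OF lim barrier_tendsto_0[OF R(1) p \<theta>(1), of k]] by (simp add: v_def W_def)
  have le: "u q \<le> k * W q" for q
  proof (rule ccontr)
    assume "\<not> u q \<le> k * W q"
    then have "0 < v q" by (simp add: v_def)
    then obtain m where m: "0 < v m" "\<And>z. v z \<le> v m"
      using attains_positive_max[OF v_cont v_lim] by blast
    obtain x0 y0 where xy: "m = (x0, y0)" by fastforce
    have "\<not> norm m \<le> b" using v_in[of m] m(1) by auto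
    then have small: "u (x0, y0) < v0" using b[of m] by (simp add: xy)
    define c where "c = k * exp_profile \<theta> y0"
    have c: "c \<ge> 0" using k0 exp_profile_pos[of \<theta> y0] by (simp add: c_def)
    have max: "u (x, y) - k * (profile p R x * exp_profile \<theta> y)
      \<le> u (x0, y0) - k * (profile p R x0 * exp_profile \<theta> y0)" for x y
      using m(2)[of "(x, y)"] by (simp add: v_def W_def xy)
    have W0: "c * profile p R x0 = k * W (x0, y0)" by (simp add: c_def W_def)
    have "- ((\<kappa> - \<theta>\<^sup>2) * (c * profile p R x0)) + 0 * measure lborel ({} :: (real^'n) set) / 1 powr (real CARD('n) + 2 * \<alpha>)
        \<le> 1 * frac_laplacian_x \<alpha> u x0 y0"
    proof (rule frac_laplacian_x_at_max[OF \<alpha>(1) ex, where \<phi> = "\<lambda>z. c * profile p R z" and \<rho> = "R / 2"])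
      show "\<bar>c * profile p R z\<bar> \<le> c * R powr (-2 * p)" for z :: "real^'n"
        using c profile_pos[OF Rp, of p z] profile_le[OF Rp p, of z] by (simp add: abs_mult mult_left_mono)
      show "1 * (u (z, y0) - c * profile p R z) + 0 * indicator {} z \<le> 1 * (u (x0, y0) - c * profile p R x0)" for z
        using max[of z y0] by (simp add: c_def mult_ac)
      show "- ((\<kappa> - \<theta>\<^sup>2) * (c * profile p R x0)) \<le>
        1 * (LINT z:{z. r < norm (x0 - z)}|lborel.
          (c * profile p R x0 - c * profile p R z) / norm (x0 - z) powr (real CARD('n) + 2 * \<alpha>))"
        if "0 < r" "r < R / 2" for r
        using that c by (intro R(2)) auto
    qed (use Rp in auto)
    then have frac: "- ((\<kappa> - \<theta>\<^sup>2) * (k * W (x0, y0))) \<le> frac_laplacian_x \<alpha> u x0 y0"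
      unfolding W0 by simp
    have "0 \<le> 1 * (minus_laplacian_y u x0 y0 + (k * profile p R x0) * exp_profile_laplacian \<theta> y0)"
      by (rule laplacian_y_at_max[OF partials]) (use max[of x0] in \<open>simp add: mult.assoc\<close>)
    then have "0 \<le> minus_laplacian_y u x0 y0 + (k * profile p R x0) * exp_profile_laplacian \<theta> y0"
      by (simp only: mult_1)
    moreover have "(k * profile p R x0) * exp_profile_laplacian \<theta> y0 \<le> (k * profile p R x0) * (\<theta>\<^sup>2 * exp_profile \<theta> y0)"
      using exp_profile_laplacian_le[of \<theta> y0] \<theta> k0 profile_pos[OF Rp, of p x0] by (intro mult_left_mono) auto
    moreover have "(k * profile p R x0) * (\<theta>\<^sup>2 * exp_profile \<theta> y0) = \<theta>\<^sup>2 * (k * W (x0, y0))"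
      by (simp add: W_def)
    ultimately have lap: "- (\<theta>\<^sup>2 * (k * W (x0, y0))) \<le> minus_laplacian_y u x0 y0" by linarith
    have "f (u (x0, y0)) \<le> (1 - \<kappa>) * u (x0, y0)" using f(2) pos small by blast
    then have "frac_laplacian_x \<alpha> u x0 y0 + minus_laplacian_y u x0 y0 \<le> - (\<kappa> * u (x0, y0))"
      using eq[of x0 y0] by (simp add: algebra_simps)
    then have "\<kappa> * u (x0, y0) \<le> \<kappa> * (k * W (x0, y0))"
      using frac lap unfolding left_diff_distrib by linarith
    moreover have "\<kappa> > 0" using \<theta> zero_le_power2[of \<theta>] by linarith
    ultimately have "u (x0, y0) \<le> k * W (x0, y0)" by simp
    then show False using m(1) by (simp add: v_def xy)
  qed
  show ?thesis
  proof (rule that[of "k * 2 powr p"])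
    show "k * 2 powr p > 0" using k0 by simp
    fix x y
    have e: "- 2 * p = - real CARD('n) - 2 * \<alpha>" by (simp add: p_def)
    have "u (x, y) \<le> k * W (x, y)" by (rule le)
    also have "\<dots> \<le> k * ((2 powr p * (1 + norm x) powr (- 2 * p)) * exp (- \<theta> * norm y))"
      unfolding W_def using profile_upper[OF R(1) p, of x] exp_profile_bounds(2)[of \<theta> y] \<theta> k0
        profile_pos[OF Rp, of p x] exp_profile_pos[of \<theta> y]
      by (intro mult_left_mono mult_mono) auto
    finally show "u (x, y) \<le> k * 2 powr p * (1 + norm x) powr (- real CARD('n) - 2 * \<alpha>) * exp (- \<theta> * norm y)"
      unfolding e by (simp add: mult.assoc)
  qed
qed


text \<open>The gap \<open>\<theta>\<^sup>2 - \<kappa>\<close> is shared equally: one half \<open>\<eta>\<close> pays for the fractional part, the other one for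
  the deviation of the Laplacian of the exponential from \<open>\<theta>\<^sup>2\<close> when \<open>|y| \<ge> L\<close>. For \<open>|y| < L\<close> the constant
  \<open>K\<close> collects all terms of the wrong sign, and \<open>\<delta>\<close> is small enough for the nonlocal gain from the unit
  ball to outweigh \<open>K * \<delta> * W\<close>.\<close>

lemma decay_lower_bound:
  fixes u :: "(real^'n) \<times> (real^'m) \<Rightarrow> real"
  assumes \<alpha>: "0 < \<alpha>" "\<alpha> < 1"
    and sol: "classical_solution \<alpha> f u"
    and pos: "\<And>q. 0 < u q"
    and lim: "(u \<longlongrightarrow> 0) at_infinity"
    and \<theta>: "0 < \<theta>" "\<kappa> < \<theta>\<^sup>2" and \<kappa>: "0 < \<kappa>"
    and f: "0 < v0" "\<And>v. 0 < v \<Longrightarrow> v < v0 \<Longrightarrow> (1 - \<kappa>) * v \<le> f v"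
    and \<Lambda>: "0 \<le> \<Lambda>" "\<And>q. - (\<Lambda> * u q) \<le> f (u q)"
  obtains C where "C > 0"
    "\<And>x y. C * (1 + norm x) powr (- real CARD('n) - 2 * \<alpha>) * exp (- \<theta> * norm y) \<le> u (x, y)"
proof -
  define s where "s = real CARD('n) + 2 * \<alpha>"
  define p where "p = s / 2"
  have s: "s > 0" using \<alpha> by (simp add: s_def add_nonneg_pos)
  then have p: "p > 0" by (simp add: p_def)
  have cont: "continuous_on UNIV u" and ex: "\<And>x y. frac_laplacian_x_exists \<alpha> u x y"
    and partials: "\<And>i. has_partial_y i u" "\<And>i. has_partial_y i (partial_y i u)"
    and eq: "\<And>x y. frac_laplacian_x \<alpha> u x y + minus_laplacian_y u x y + u (x, y) = f (u (x, y))"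
    using sol by (auto simp: classical_solution_def)
  define \<eta> where "\<eta> = (\<theta>\<^sup>2 - \<kappa>) / 2"
  have \<eta>: "\<eta> > 0" using \<theta> by (simp add: \<eta>_def)
  obtain R where R: "1 \<le> R"
    "\<And>(x::real^'n) r \<sigma> c. 0 < r \<Longrightarrow> r < R / 2 \<Longrightarrow> \<bar>\<sigma>\<bar> \<le> 1 \<Longrightarrow> 0 \<le> c \<Longrightarrow>
      - (\<eta> * (c * profile p R x)) \<le>
      \<sigma> * (LINT z:{z. r < norm (x - z)}|lborel.
        (c * profile p R x - c * profile p R z) / norm (x - z) powr s)"
    using profile_barrier[OF \<alpha> \<eta>, where 'n = 'n, folded s_def, folded p_def] by blast
  have Rp: "R > 0" using R by simp
  define W where "W = (\<lambda>q. profile p R (fst q :: real^'n) * exp_profile \<theta> (snd q :: real^'m))"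
  have W_pos: "W q > 0" for q
    unfolding W_def using profile_pos[OF Rp] exp_profile_pos by (intro mult_pos_pos)
  have \<psi>_le: "exp_profile \<theta> y \<le> 1" for y :: "real^'m"
    using exp_profile_bounds(2)[of \<theta> y] \<theta> by (auto elim!: order_trans)
  have \<phi>_le: "profile p R x \<le> 2 powr p * (1 + norm x) powr (- s)" for x :: "real^'n"
    using profile_upper[OF R(1) p, of x] by (simp add: p_def)
  have W_le: "W (x, y) \<le> 2 powr p * (1 + norm x) powr (- s)" for x y
  proof -
    have "W (x, y) \<le> profile p R x * 1"
      unfolding W_def fst_conv snd_conv using \<psi>_le profile_pos[OF Rp, of p x] by (intro mult_left_mono) auto
    then show ?thesis using \<phi>_le[of x] by linarith
  qed
  obtain b where b: "\<And>q. b \<le> norm q \<Longrightarrow> u q < v0"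
    using lim f(1) pos unfolding Lim_at_infinity dist_real_def by (metis abs_of_pos diff_zero)
  define N where "N = \<theta>\<^sup>2 + \<theta> * real CARD('m)"
  have N: "N > 0" using \<theta> by (simp add: N_def add_pos_nonneg)
  define L where "L = max b (N / \<eta>)"
  have L: "L > 0" "b \<le> L" "N / L \<le> \<eta>"
  proof -
    have "N / \<eta> > 0" using N \<eta> by simp
    then show "L > 0" unfolding L_def by linarith
    moreover have "N / \<eta> \<le> L" by (simp add: L_def)
    ultimately show "N / L \<le> \<eta>" using \<eta> by (simp add: pos_divide_le_eq mult.commute)
    show "b \<le> L" by (simp add: L_def)
  qed
  define Q where "Q = (cball 0 2 :: (real^'n) set) \<times> (cball 0 L :: (real^'m) set)"
  have "\<exists>q\<in>Q. \<forall>z\<in>Q. u q \<le> u z"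
  proof (rule continuous_attains_inf)
    show "Q \<noteq> {}" unfolding Q_def using L(1) by (auto intro!: exI[of _ 0])
  qed (auto simp: Q_def intro!: compact_Times continuous_on_subset[OF cont])
  then obtain q0 where q0: "\<And>z. z \<in> Q \<Longrightarrow> u q0 \<le> u z" by blast
  define c0 where "c0 = u q0"
  have c0: "c0 > 0" using pos by (simp add: c0_def)
  define V where "V = measure lborel (cball 0 1 :: (real^'n) set)"
  have V: "V > 0" by (simp add: V_def content_cball)
  define K where "K = \<eta> + \<theta> * real CARD('m) + \<Lambda> + 1"
  have K: "K > 0" using \<eta> \<theta> \<Lambda>(1) by (simp add: K_def add_pos_nonneg)
  define \<delta> where "\<delta> = min (c0 / (2 * 2 powr p)) (c0 * V / (4 * (2 powr p * K)))"
  have \<delta>: "\<delta> > 0" "\<delta> * 2 powr p \<le> c0 / 2" "\<delta> * (2 powr p * K) < c0 / 2 * V"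
  proof -
    show "\<delta> > 0" using c0 V K by (simp add: \<delta>_def)
    have "\<delta> * 2 powr p \<le> c0 / (2 * 2 powr p) * 2 powr p"
      by (rule mult_right_mono) (auto simp: \<delta>_def)
    then show "\<delta> * 2 powr p \<le> c0 / 2" by simp
    have "\<delta> * (2 powr p * K) \<le> c0 * V / (4 * (2 powr p * K)) * (2 powr p * K)"
      by (rule mult_right_mono) (use K in \<open>auto simp: \<delta>_def\<close>)
    also have "\<dots> = c0 * V / 4" using K by simp
    also have "\<dots> < c0 / 2 * V" using c0 V by simp
    finally show "\<delta> * (2 powr p * K) < c0 / 2 * V" .
  qed
  define v where "v = (\<lambda>q. \<delta> * W q - u q)"
  have v_cont: "continuous_on UNIV v"
    unfolding v_def W_def by (intro continuous_on_diff cont barrier_continuous Rp)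
  have v_lim: "(v \<longlongrightarrow> 0) at_infinity"
    using tendsto_diff[OF barrier_tendsto_0[OF R(1) p \<theta>(1), of \<delta>] lim] by (simp add: v_def W_def)
  \<comment> \<open>on the compact set \<open>Q\<close> the function \<open>u\<close> exceeds the barrier by a fixed margin\<close>
  have v_Q: "v q \<le> - (c0 / 2)" if "q \<in> Q" for q
  proof -
    obtain x y where q: "q = (x, y)" by fastforce
    have "(1 + norm x) powr (- s) \<le> 1 powr (- s)" by (rule powr_mono2') (use s in auto)
    then have "2 powr p * (1 + norm x) powr (- s) \<le> 2 powr p * 1" by (intro mult_left_mono) auto
    then have "W q \<le> 2 powr p" using W_le[of x y] unfolding q by linarith
    then have "\<delta> * W q \<le> \<delta> * 2 powr p" using \<delta>(1) by (intro mult_left_mono) auto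
    then show ?thesis using \<delta>(2) q0[OF that] by (simp add: v_def c0_def)
  qed
  have le: "\<delta> * W q \<le> u q" for q
  proof (rule ccontr)
    assume "\<not> \<delta> * W q \<le> u q"
    then have "0 < v q" by (simp add: v_def)
    then obtain m where m: "0 < v m" "\<And>z. v z \<le> v m"
      using attains_positive_max[OF v_cont v_lim] by blast
    obtain x0 y0 where xy: "m = (x0, y0)" by fastforce
    have uW: "u (x0, y0) < \<delta> * W (x0, y0)" using m(1) by (simp add: v_def xy)
    define c where "c = \<delta> * exp_profile \<theta> y0"
    have c: "c \<ge> 0" using \<delta>(1) exp_profile_pos[of \<theta> y0] by (simp add: c_def)
    have c\<phi>: "c * profile p R x = \<delta> * W (x, y0)" for x by (simp add: c_def W_def)
    have c_bound: "\<bar>c * profile p R z\<bar> \<le> c * R powr (-2 * p)" for z :: "real^'n"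
      using c profile_pos[OF Rp, of p z] profile_le[OF Rp p, of z] by (simp add: abs_mult mult_left_mono)
    have lower: "- (\<eta> * (c * profile p R x0)) \<le>
        - 1 * (LINT z:{z. r < norm (x0 - z)}|lborel.
          (c * profile p R x0 - c * profile p R z) / norm (x0 - z) powr s)"
      if "0 < r" "r < R / 2" for r
      using that c by (intro R(2)) auto
    have "0 \<le> - 1 * (minus_laplacian_y u x0 y0 + (\<delta> * profile p R x0) * exp_profile_laplacian \<theta> y0)"
    proof (rule laplacian_y_at_max[OF partials])
      show "- 1 * (u (x0, y) - \<delta> * profile p R x0 * exp_profile \<theta> y)
          \<le> - 1 * (u (x0, y0) - \<delta> * profile p R x0 * exp_profile \<theta> y0)" for y
        using m(2)[of "(x0, y)"] by (simp add: v_def W_def xy mult.assoc)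
    qed
    then have lap: "minus_laplacian_y u x0 y0 \<le> - (\<delta> * profile p R x0 * exp_profile_laplacian \<theta> y0)"
      by simp
    have lap_k: "minus_laplacian_y u x0 y0 \<le> - (k * (\<delta> * W (x0, y0)))"
      if "k * exp_profile \<theta> y0 \<le> exp_profile_laplacian \<theta> y0" for k
    proof -
      have "\<delta> * profile p R x0 * (k * exp_profile \<theta> y0) \<le> \<delta> * profile p R x0 * exp_profile_laplacian \<theta> y0"
        using that \<delta>(1) profile_pos[OF Rp, of p x0] by (intro mult_left_mono) auto
      moreover have "\<delta> * profile p R x0 * (k * exp_profile \<theta> y0) = k * (\<delta> * W (x0, y0))"
        by (simp add: W_def)
      ultimately show ?thesis using lap by linarith
    qed
    show False
    proof (cases "L \<le> norm y0")
      case True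
      have "- (\<eta> * (c * profile p R x0)) + 0 * measure lborel ({} :: (real^'n) set) / 1 powr s
        \<le> - 1 * frac_laplacian_x \<alpha> u x0 y0"
        unfolding s_def
      proof (rule frac_laplacian_x_at_max[OF \<alpha>(1) ex, where \<phi> = "\<lambda>z. c * profile p R z" and \<rho> = "R / 2"])
        show "- 1 * (u (z, y0) - c * profile p R z) + 0 * indicator {} z
            \<le> - 1 * (u (x0, y0) - c * profile p R x0)" for z
          using m(2)[of "(z, y0)"] by (simp add: v_def c\<phi> xy)
      qed (use Rp c_bound lower[unfolded s_def] in auto)
      then have frac: "frac_laplacian_x \<alpha> u x0 y0 \<le> \<eta> * (\<delta> * W (x0, y0))"
        unfolding c\<phi> by simp
      have "(\<theta>\<^sup>2 - \<eta>) * exp_profile \<theta> y0 \<le> (\<theta>\<^sup>2 - N / L) * exp_profile \<theta> y0"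
        using L(3) exp_profile_pos[of \<theta> y0] by (intro mult_right_mono) auto
      also have "\<dots> \<le> exp_profile_laplacian \<theta> y0"
        using exp_profile_laplacian_ge(2)[of \<theta> L y0] L(1) True \<theta>(1) by (simp add: N_def)
      finally have "minus_laplacian_y u x0 y0 \<le> - ((\<theta>\<^sup>2 - \<eta>) * (\<delta> * W (x0, y0)))"
        by (rule lap_k)
      moreover have "(\<theta>\<^sup>2 - \<eta>) * (\<delta> * W (x0, y0)) - \<eta> * (\<delta> * W (x0, y0)) = \<kappa> * (\<delta> * W (x0, y0))"
        unfolding left_diff_distrib[symmetric] \<eta>_def by (simp add: field_simps)
      moreover have "- (\<kappa> * u (x0, y0)) \<le> frac_laplacian_x \<alpha> u x0 y0 + minus_laplacian_y u x0 y0"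
      proof -
        have "norm y0 \<le> norm m" unfolding xy by (rule norm_snd_le)
        then have "u (x0, y0) < v0" using b[of m] True L(2) by (simp add: xy)
        then have "(1 - \<kappa>) * u (x0, y0) \<le> f (u (x0, y0))" using f(2) pos by blast
        then show ?thesis using eq[of x0 y0] by (simp add: algebra_simps)
      qed
      ultimately have "\<kappa> * (\<delta> * W (x0, y0)) \<le> \<kappa> * u (x0, y0)" using frac by linarith
      then show False using \<kappa> uW by simp
    next
      case False
      \<comment> \<open>so the unit ball, where \<open>u\<close> exceeds \<open>\<delta> * W\<close> by \<open>c0 / 2\<close>, is at distance at least 1 from \<open>x0\<close>\<close>
      have far: "2 < norm x0"
      proof (rule ccontr)
        assume "\<not> 2 < norm x0"
        then have "m \<in> Q" using False by (simp add: Q_def xy)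
        then show False using v_Q[of m] m(1) c0 by simp
      qed
      have "- (\<eta> * (c * profile p R x0)) + c0 / 2 * measure lborel (cball 0 1 :: (real^'n) set) / (1 + norm x0) powr s
        \<le> - 1 * frac_laplacian_x \<alpha> u x0 y0"
        unfolding s_def
      proof (rule frac_laplacian_x_at_max[OF \<alpha>(1) ex, where \<phi> = "\<lambda>z. c * profile p R z" and \<rho> = "R / 2"])
        show "- 1 * (u (z, y0) - c * profile p R z) + c0 / 2 * indicator (cball 0 1) z
            \<le> - 1 * (u (x0, y0) - c * profile p R x0)" for z
        proof (cases "norm z \<le> 1")
          case True
          then have "(z, y0) \<in> Q" using False by (simp add: Q_def)
          then show ?thesis using v_Q[of "(z, y0)"] m(1) True by (simp add: v_def c\<phi> xy)
        next
          case False
          then show ?thesis using m(2)[of "(z, y0)"] by (simp add: v_def c\<phi> xy)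
        qed
        show "1 \<le> norm (x0 - z)" if "z \<in> cball 0 1" for z
          using that far norm_triangle_ineq2[of x0 z] by simp
        show "norm (x0 - z) \<le> 1 + norm x0" if "z \<in> cball 0 1" for z
          using that norm_triangle_ineq4[of x0 z] by simp
      qed (use Rp c_bound lower[unfolded s_def] c0 in auto)
      then have frac: "frac_laplacian_x \<alpha> u x0 y0 \<le> \<eta> * (\<delta> * W (x0, y0)) - c0 / 2 * V / (1 + norm x0) powr s"
        unfolding c\<phi> V_def by linarith
      have "minus_laplacian_y u x0 y0 \<le> - (- (\<theta> * real CARD('m)) * (\<delta> * W (x0, y0)))"
        by (rule lap_k) (use exp_profile_laplacian_ge(1)[of \<theta> y0] \<theta> in auto)
      moreover have "- ((\<Lambda> + 1) * (\<delta> * W (x0, y0))) \<le> frac_laplacian_x \<alpha> u x0 y0 + minus_laplacian_y u x0 y0"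
      proof -
        have "(\<Lambda> + 1) * u (x0, y0) \<le> (\<Lambda> + 1) * (\<delta> * W (x0, y0))"
          using \<Lambda>(1) uW by (intro mult_left_mono) auto
        moreover have "(\<Lambda> + 1) * u (x0, y0) = \<Lambda> * u (x0, y0) + u (x0, y0)" by (simp add: distrib_right)
        ultimately show ?thesis using eq[of x0 y0] \<Lambda>(2)[of "(x0, y0)"] by linarith
      qed
      moreover have "K * (\<delta> * W (x0, y0)) = \<eta> * (\<delta> * W (x0, y0)) + \<theta> * real CARD('m) * (\<delta> * W (x0, y0))
          + (\<Lambda> + 1) * (\<delta> * W (x0, y0))"
        unfolding K_def by (simp only: distrib_right)
      ultimately have "c0 / 2 * V / (1 + norm x0) powr s \<le> K * (\<delta> * W (x0, y0))"
        using frac unfolding mult_minus_left by linarith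
      also have "\<dots> \<le> K * (\<delta> * (2 powr p * (1 + norm x0) powr (- s)))"
        using K \<delta>(1) W_le by (intro mult_left_mono) auto
      also have "\<dots> = \<delta> * (2 powr p * K) / (1 + norm x0) powr s"
        by (simp add: powr_minus divide_inverse)
      finally have "c0 / 2 * V / (1 + norm x0) powr s \<le> \<delta> * (2 powr p * K) / (1 + norm x0) powr s" .
      moreover have "0 < 1 + norm x0" using far by linarith
      then have "0 < (1 + norm x0) powr s" by simp
      ultimately have "c0 / 2 * V \<le> \<delta> * (2 powr p * K)"
        unfolding divide_le_cancel by blast
      then show False using \<delta>(3) by simp
    qed
  qed
  show ?thesis
  proof (rule that[of "\<delta> * R powr (- s) * exp (- \<theta>)"])
    show "\<delta> * R powr (- s) * exp (- \<theta>) > 0" using \<delta>(1) Rp by simp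
    fix x y
    have e: "- s = - real CARD('n) - 2 * \<alpha>" by (simp add: s_def)
    have "\<delta> * ((R powr (- s) * (1 + norm x) powr (- s)) * (exp (- \<theta>) * exp (- \<theta> * norm y))) \<le> \<delta> * W (x, y)"
      unfolding W_def using profile_lower[OF R(1) p, of x] exp_profile_bounds(1)[of \<theta> y] \<theta>(1) \<delta>(1)
        profile_pos[OF Rp, of p x]
      by (intro mult_left_mono mult_mono) (auto simp: p_def)
    also have "\<dots> \<le> u (x, y)" by (rule le)
    finally show "\<delta> * R powr (- s) * exp (- \<theta>) * (1 + norm x) powr (- real CARD('n) - 2 * \<alpha>) * exp (- \<theta> * norm y) \<le> u (x, y)"
      unfolding e[symmetric] by (simp add: mult_ac)
  qed
qed


section \<open>The two-sided estimate\<close>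

text \<open>Near 0 the bound is the hypothesis; on \<open>{v0..U}\<close> the function is bounded, and a constant is at most
  a multiple of \<open>v\<close> because \<open>v \<ge> v0\<close>.\<close>

lemma linear_lower_bound:
  fixes f :: "real \<Rightarrow> real"
  assumes f: "continuous_on {0<..} f" and v0: "0 < v0" and k: "\<And>v. 0 < v \<Longrightarrow> v < v0 \<Longrightarrow> - (k * v) \<le> f v"
  obtains \<Lambda> where "0 \<le> \<Lambda>" "\<And>v. 0 < v \<Longrightarrow> v \<le> U \<Longrightarrow> - (\<Lambda> * v) \<le> f v"
proof -
  have "continuous_on {v0..U} f" by (rule continuous_on_subset[OF f]) (use v0 in auto)
  then have "bounded (f ` {v0..U})"
    by (intro compact_imp_bounded compact_continuous_image) auto
  then obtain F where F: "F > 0" "\<forall>t\<in>f ` {v0..U}. norm t \<le> F" unfolding bounded_pos by blast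
  show ?thesis
  proof (rule that[of "max \<bar>k\<bar> (F / v0)"])
    show "0 \<le> max \<bar>k\<bar> (F / v0)" by (simp add: le_max_iff_disj)
    fix v assume v: "0 < v" "v \<le> U"
    show "- (max \<bar>k\<bar> (F / v0) * v) \<le> f v"
    proof (cases "v < v0")
      case True
      have "k * v \<le> max \<bar>k\<bar> (F / v0) * v" using v by (intro mult_right_mono) auto
      then show ?thesis using k[OF v(1) True] by linarith
    next
      case False
      then have "\<bar>f v\<bar> \<le> F" using F(2) v by auto
      moreover have "F \<le> F / v0 * v" using False F(1) v0 by (simp add: pos_le_divide_eq mult_left_mono)
      moreover have "F / v0 * v \<le> max \<bar>k\<bar> (F / v0) * v" using v by (intro mult_right_mono) auto
      ultimately show ?thesis by (simp only: abs_le_iff) linarith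
    qed
  qed
qed

theorem theorem1p1:
  fixes \<alpha> :: real and f :: "real \<Rightarrow> real" and A B :: ereal
    and u :: "(real^'n) \<times> (real^'m) \<Rightarrow> real"
  assumes "0 < \<alpha>" "\<alpha> < 1"
    and "continuous_on {0<..} f"
    and "B = Liminf (at_right 0) (\<lambda>v. ereal (f v / v))"
    and "A = Limsup (at_right 0) (\<lambda>v. ereal (f v / v))"
    and "- \<infinity> < B" "B \<le> A" "A < 1"
    and "classical_solution \<alpha> f u"
    and "\<And>x y. 0 < u (x, y)"
    and "(u \<longlongrightarrow> 0) at_infinity"
  shows "\<forall>\<^sub>F \<epsilon> in at_right (0::real).
    (let \<theta>1 = sqrt (1 - real_of_ereal A) - \<epsilon>;
         \<theta>2 = sqrt (1 - real_of_ereal B) + \<epsilon>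
     in \<exists>C>1. \<forall>x y.
       inverse C * (1 + norm x) powr (- real CARD('n) - 2 * \<alpha>) * exp (- \<theta>2 * norm y) \<le> u (x, y) \<and>
       u (x, y) \<le> C * (1 + norm x) powr (- real CARD('n) - 2 * \<alpha>) * exp (- \<theta>1 * norm y))"
proof -
  note \<alpha> = assms(1,2) and f = assms(3) and sol = assms(9) and lim = assms(11)
  have pos: "0 < u q" for q using assms(10)[of "fst q" "snd q"] by simp
  obtain a where a: "A = ereal a" using assms(6-8) by (cases A) auto
  obtain b where b: "B = ereal b" using assms(6-8) a by (cases B) auto
  have ab: "b \<le> a" "a < 1" using assms(7,8) unfolding a b by auto
  define \<tau> where "\<tau> = sqrt (1 - a)"
  have \<tau>: "\<tau> > 0" "\<tau>\<^sup>2 = 1 - a" using ab by (simp_all add: \<tau>_def)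
  define \<sigma> where "\<sigma> = sqrt (1 - b)"
  have \<sigma>: "\<sigma> > 0" "\<sigma>\<^sup>2 = 1 - b" using ab by (simp_all add: \<sigma>_def)
  have cont: "continuous_on UNIV u" using sol by (simp add: classical_solution_def)
  obtain q0 where q0: "\<And>q. u q \<le> u q0"
    using attains_positive_max[OF cont lim pos[of 0]] by blast
  \<comment> \<open>the estimate holds for every \<open>\<epsilon>\<close> below \<open>sqrt (1 - A)\<close>, which keeps the upper rate positive\<close>
  have main: "\<exists>C>1. \<forall>x y.
       inverse C * (1 + norm x) powr (- real CARD('n) - 2 * \<alpha>) * exp (- (\<sigma> + \<epsilon>) * norm y) \<le> u (x, y) \<and>
       u (x, y) \<le> C * (1 + norm x) powr (- real CARD('n) - 2 * \<alpha>) * exp (- (\<tau> - \<epsilon>) * norm y)"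
    if \<epsilon>: "0 < \<epsilon>" "\<epsilon> < \<tau>" for \<epsilon>
  proof -
    have "(\<tau> - \<epsilon>)\<^sup>2 < \<tau>\<^sup>2" using \<epsilon> by (intro power_strict_mono) auto
    then obtain \<kappa>1 where \<kappa>1: "(\<tau> - \<epsilon>)\<^sup>2 < \<kappa>1" "\<kappa>1 < 1 - a" using dense \<tau>(2) by metis
    have "\<sigma>\<^sup>2 < (\<sigma> + \<epsilon>)\<^sup>2" using \<epsilon> \<sigma> by (intro power_strict_mono) auto
    then obtain \<kappa>2 where \<kappa>2: "1 - b < \<kappa>2" "\<kappa>2 < (\<sigma> + \<epsilon>)\<^sup>2" using dense \<sigma>(2) by metis
    have "Limsup (at_right 0) (\<lambda>v. ereal (f v / v)) < ereal (1 - \<kappa>1)"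
      using \<kappa>1 unfolding assms(5)[symmetric] a by simp
    then have "\<forall>\<^sub>F v in at_right 0. ereal (f v / v) < ereal (1 - \<kappa>1)" by (rule Limsup_lessD)
    then obtain v1 where v1: "v1 > 0" "\<And>v. 0 < v \<Longrightarrow> v < v1 \<Longrightarrow> f v / v < 1 - \<kappa>1"
      unfolding eventually_at_right_field by auto
    have f1: "f v \<le> (1 - \<kappa>1) * v" if "0 < v" "v < v1" for v
      using v1(2)[OF that] that by (simp add: pos_divide_less_eq)
    have "ereal (1 - \<kappa>2) < Liminf (at_right 0) (\<lambda>v. ereal (f v / v))"
      using \<kappa>2 unfolding assms(4)[symmetric] b by simp
    then have "\<forall>\<^sub>F v in at_right 0. ereal (1 - \<kappa>2) < ereal (f v / v)" by (rule less_LiminfD)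
    then obtain v2 where v2: "v2 > 0" "\<And>v. 0 < v \<Longrightarrow> v < v2 \<Longrightarrow> 1 - \<kappa>2 < f v / v"
      unfolding eventually_at_right_field by auto
    have f2: "(1 - \<kappa>2) * v \<le> f v" if "0 < v" "v < v2" for v
      using v2(2)[OF that] that by (simp add: pos_less_divide_eq)
    have "- ((\<kappa>2 - 1) * v) \<le> f v" if "0 < v" "v < v2" for v
      using f2[OF that] unfolding mult_minus_left[symmetric] by simp
    then obtain \<Lambda> where \<Lambda>: "0 \<le> \<Lambda>" "\<And>v. 0 < v \<Longrightarrow> v \<le> u q0 \<Longrightarrow> - (\<Lambda> * v) \<le> f v"
      using linear_lower_bound[OF f v2(1), of "\<kappa>2 - 1" "u q0"] by blast
    obtain C1 where C1: "C1 > 0"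
      "\<And>x y. u (x, y) \<le> C1 * (1 + norm x) powr (- real CARD('n) - 2 * \<alpha>) * exp (- (\<tau> - \<epsilon>) * norm y)"
      using decay_upper_bound[OF \<alpha> sol pos lim _ \<kappa>1(1) v1(1) f1] \<epsilon> by auto
    obtain C2 where C2: "C2 > 0"
      "\<And>x y. C2 * (1 + norm x) powr (- real CARD('n) - 2 * \<alpha>) * exp (- (\<sigma> + \<epsilon>) * norm y) \<le> u (x, y)"
      using decay_lower_bound[OF \<alpha> sol pos lim _ \<kappa>2(2) _ v2(1) f2 \<Lambda>(1)] \<epsilon> \<sigma> \<kappa>2 ab \<Lambda>(2)[OF pos q0] by auto
    define C where "C = C1 + inverse C2 + 1"
    have C: "C > 1" "C1 \<le> C" using C1(1) C2(1) by (simp_all add: C_def add_pos_pos)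
    have "inverse C2 \<le> C" using C1(1) by (simp add: C_def)
    then have "inverse C \<le> C2" using C2(1) le_imp_inverse_le[of "inverse C2" C] by simp
    then have "inverse C * ((1 + norm x) powr (- real CARD('n) - 2 * \<alpha>) * exp (- (\<sigma> + \<epsilon>) * norm y))
        \<le> C2 * ((1 + norm x) powr (- real CARD('n) - 2 * \<alpha>) * exp (- (\<sigma> + \<epsilon>) * norm y))"
      for x :: "real^'n" and y :: "real^'m" by (intro mult_right_mono) auto
    moreover have "C1 * ((1 + norm x) powr (- real CARD('n) - 2 * \<alpha>) * exp (- (\<tau> - \<epsilon>) * norm y))
        \<le> C * ((1 + norm x) powr (- real CARD('n) - 2 * \<alpha>) * exp (- (\<tau> - \<epsilon>) * norm y))"
      for x :: "real^'n" and y :: "real^'m" using C(2) by (intro mult_right_mono) auto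
    ultimately show ?thesis
      using C(1) C1(2) C2(2) unfolding mult.assoc by (intro exI[of _ C]) (meson order_trans)
  qed
  show ?thesis
    unfolding Let_def a b real_of_ereal.simps \<tau>_def[symmetric] \<sigma>_def[symmetric] eventually_at_right_field
    using main \<tau>(1) by (intro exI[of _ \<tau>]) blast
qed

end
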